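(* Let $n$ be a positive integer and $r$ a non-negative integer. The number of symplectic tableaux (on the alphabet $1<\bar1<2<\bar2<\cdots<n<\bar n$) of height at most $n$ and width at most $r$ is $$\prod_{i=1}^{n+1}\prod_{j=1}^n\frac{i+j+r-1}{i+j-1},$$ and the number of such tableaux weighted by $(-1)^{|T|}$, i.e. $\sum_T(-1)^{|T|}$ over all symplectic tableaux $T$ of height at most $n$ and width at most $r$, is $$(-1)^{rn}\prod_{i=1}^n\frac{i+\lfloor r/2\rfloor}{i}\ \prod_{i=1}^n\prod_{j=1}^{n-1}\frac{i+j+r}{i+j}.$$
   Context: A symplectic tableau is a semi-standard Young tableau (weakly increasing along rows, strictly increasing down columns) of partition shape on the ordered alphabet $1<\bar1<2<\bar2<\cdots<n<\bar n$ such that all entries in row $k$ are at least $k$. The empty tableau is included. The height is the number of rows, the width is the number of columns, and $|T|$ is the number of squares of $T$. *)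

theory Defs
  imports Complex_Main
begin

text \<open>Letters: \<open>Plain k\<close> is $k$ and \<open>Barred k\<close> is $\bar k$, ordered by
  $\cdots < k < \bar k < k+1 < \overline{k+1} < \cdots$.\<close>

datatype letter = Plain nat | Barred nat

primrec letter_rank :: "letter \<Rightarrow> nat" where
  "letter_rank (Plain k) = 2 * k"
| "letter_rank (Barred k) = 2 * k + 1"

lemma letter_rank_eq_iff: "letter_rank x = letter_rank y \<longleftrightarrow> x = y"
  by (cases x; cases y; simp; presburger)

instantiation letter :: linorder
begin

definition less_eq_letter :: "letter \<Rightarrow> letter \<Rightarrow> bool" where
  "x \<le> y \<longleftrightarrow> letter_rank x \<le> letter_rank y"

definition less_letter :: "letter \<Rightarrow> letter \<Rightarrow> bool" where
  "x < y \<longleftrightarrow> letter_rank x < letter_rank y"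

instance
  by standard (auto simp: less_eq_letter_def less_letter_def simp flip: letter_rank_eq_iff)

end

definition alphabet :: "nat \<Rightarrow> letter set" where
  "alphabet n = Plain ` {1..n} \<union> Barred ` {1..n}"

text \<open>A tableau is the list of its rows, from top to bottom; the empty tableau is the empty
  list. Rows must be nonempty so that every tableau is represented by a unique list and its
  number of rows is the length of that list. Rows are numbered from 1 in the mathematics and
  from 0 in the list.\<close>

type_synonym tableau = "letter list list"

definition shape :: "tableau \<Rightarrow> nat list" where
  "shape T = map length T"

definition is_partition :: "nat list \<Rightarrow> bool" where
  "is_partition la \<longleftrightarrow> sorted_wrt (\<ge>) la \<and> 0 \<notin> set la"

definition semistandard :: "tableau \<Rightarrow> bool" where
  "semistandard T \<longleftrightarrow>
     is_partition (shape T) \<and>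
     (\<forall>R \<in> set T. sorted R) \<and>
     (\<forall>i j. Suc i < length T \<longrightarrow> j < length (T ! Suc i) \<longrightarrow> T ! i ! j < T ! Suc i ! j)"

definition symplectic_tableau :: "nat \<Rightarrow> tableau \<Rightarrow> bool" where
  "symplectic_tableau n T \<longleftrightarrow>
     semistandard T \<and>
     (\<forall>R \<in> set T. set R \<subseteq> alphabet n) \<and>
     (\<forall>i < length T. \<forall>x \<in> set (T ! i). Plain (Suc i) \<le> x)"

definition height :: "tableau \<Rightarrow> nat" where
  "height T = length T"

definition width :: "tableau \<Rightarrow> nat" where
  "width T = (case T of [] \<Rightarrow> 0 | R # _ \<Rightarrow> length R)"

definition num_squares :: "tableau \<Rightarrow> nat" where
  "num_squares T = sum_list (shape T)"

definition symplectic_tableaux :: "nat \<Rightarrow> nat \<Rightarrow> tableau set" where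
  "symplectic_tableaux n r = {T. symplectic_tableau n T \<and> height T \<le> n \<and> width T \<le> r}"

end

theory Submission
  imports Defs "HOL-Computational_Algebra.Polynomial"
begin

text \<open>
  Removing the letters \<open>n\<close> and its barred version from a tableau of shape \<open>la\<close> corresponds to row
  operations in the determinant of the \<open>q k (l i)\<close>, where \<open>l\<close> is \<open>la\<close> plus the staircase
  \<open>(n, ..., 1)\<close> and \<open>q 0, ..., q (n - 1)\<close> are odd polynomials of degrees \<open>1, 3, ..., 2n - 1\<close>. Hence
  this determinant is a constant multiple of the number of symplectic tableaux of shape \<open>la\<close>, for
  every choice of the \<open>q k\<close>. Summing over all \<open>la\<close> in the box, that is, over all strictly
  decreasing \<open>l\<close> in \<open>{1..N}\<close> with \<open>N = n + r\<close>, gives a Pfaffian whose entries are polynomials in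
  \<open>N\<close>. If many of the \<open>q k\<close> vanish at \<open>0, ..., m\<close>, then the corresponding entries have zeros at
  \<open>N = m\<close>, double ones when both indices are of this kind, and so the Pfaffian has a zero of high
  order. Adapting the \<open>q k\<close> to each \<open>m\<close> in turn produces as many zeros as the degree allows; the
  remaining constant is found at \<open>r = 0\<close>. With the signs the same works for a polynomial in
  \<open>tau N\<close>, which is \<open>N\<close> or \<open>- 1 - N\<close> according to the parity of \<open>N\<close>.
\<close>

section \<open>Exterior products and Pfaffians\<close>

text \<open>Oddness is what makes the branching step repeatable: the row operations need a zero row
  at \<open>0\<close>, and the centred second differences that two of them produce are again odd,
  hence again zero there. It also makes the summation polynomials symmetric or antisymmetric under
  \<open>x \<mapsto> - 1 - x\<close>, so in the unsigned case each zero at \<open>m\<close> has a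
  twin at \<open>- 1 - m\<close>. No family \<open>q\<close> shows all zeros at once: an odd
  polynomial of degree \<open>2k + 1\<close> can vanish at \<open>0, ..., m\<close> only if
  \<open>k \<ge> m\<close>, which leaves \<open>n - m\<close> indices for each \<open>m\<close>. But
  the Pfaffians of two families agree up to a nonzero factor, so zeros found with one belong to all.
  The count closes exactly: the unsigned degree is the sum of the \<open>2k + 2\<close>, which is
  \<open>n(n + 1)\<close>, and so is the sum of the \<open>2(n - m)\<close>. An alternating sum does
  not raise degrees, so the signed degree is the sum of the \<open>2k + 1\<close>, which is
  \<open>n * n\<close>; the multiplicities there are \<open>n - m\<close> at \<open>tau m\<close>
  and \<open>n - m - 1\<close> at \<open>- 1 - tau m\<close>. A Pfaffian proper needs an even number
  of indices. Expanding a product of factors \<open>1 + p i\<close> in an exterior algebra covers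
  odd \<open>n\<close> too, the vector of sums acting as a border.\<close>

definition wsign :: "nat \<Rightarrow> nat set \<Rightarrow> real" where
  "wsign k J = (- 1) ^ card {x \<in> J. k < x}"

text \<open>A function on finite sets of indices is read as an element of an exterior algebra. The sign
  counts the larger indices, so that it does not change when a new smallest index is adjoined to
  the set.\<close>

definition wedge :: "(nat \<Rightarrow> real) \<Rightarrow> (nat set \<Rightarrow> real) \<Rightarrow> nat set \<Rightarrow> real" where
  "wedge v X J = (\<Sum>k\<in>J. wsign k J * v k * X (J - {k}))"

text \<open>The product with a 2-form, summed over ordered pairs, so that a skew \<open>A\<close> is
  counted twice. \<open>A\<close> may be any matrix, which allows the decomposable case
  \<open>u k * v l\<close>.\<close>

definition wedge2 :: "(nat \<Rightarrow> nat \<Rightarrow> real) \<Rightarrow> (nat set \<Rightarrow> real) \<Rightarrow> nat set \<Rightarrow> real" where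
  "wedge2 A X J = (\<Sum>k\<in>J. \<Sum>l\<in>J - {k}. wsign k J * wsign l (J - {k}) * A k l * X (J - {k} - {l}))"

definition vacuum :: "nat set \<Rightarrow> real" where
  "vacuum J = (if J = {} then 1 else 0)"

lemma wedge_empty [simp]: "wedge v X {} = 0"
  by (simp add: wedge_def)

lemma wsign_swap:
  assumes "finite J" "k \<in> J" "l \<in> J" "k \<noteq> l"
  shows "wsign k J * wsign l (J - {k}) = - (wsign l J * wsign k (J - {l}))"
proof -
  have *: "wsign a J * wsign b (J - {a}) = - (wsign b J * wsign a (J - {b}))"
    if "a \<in> J" "b \<in> J" "a < b" for a b
  proof -
    have "{x \<in> J - {a}. b < x} = {x \<in> J. b < x}"
      using that by auto
    moreover have "{x \<in> J. a < x} = insert b {x \<in> J - {b}. a < x}"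
      using that by auto
    ultimately show ?thesis
      using assms(1) by (simp add: wsign_def)
  qed
  from assms(4) consider "k < l" | "l < k"
    by linarith
  then show ?thesis
    using *[of k l] *[of l k] assms(2,3) by cases simp_all
qed

text \<open>Taking out two indices in the opposite order reverses the sign. Hence only the skew part
  of \<open>A\<close> acts, and anticommutation of vectors is a special case.\<close>

lemma wedge2_transpose: "wedge2 (\<lambda>k l. A l k) X J = - wedge2 A X J"
proof (cases "finite J")
  case True
  have "wedge2 (\<lambda>k l. A l k) X J =
      (\<Sum>(k, l)\<in>Sigma J (\<lambda>k. J - {k}). wsign k J * wsign l (J - {k}) * A l k * X (J - {k} - {l}))"
    unfolding wedge2_def using True by (subst sum.Sigma) auto
  also have "\<dots> = (\<Sum>(k, l)\<in>Sigma J (\<lambda>k. J - {k}).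
      wsign l J * wsign k (J - {l}) * A k l * X (J - {l} - {k}))"
    by (rule sum.reindex_bij_witness[of _ "\<lambda>(k, l). (l, k)" "\<lambda>(k, l). (l, k)"]) auto
  also have "\<dots> = (\<Sum>(k, l)\<in>Sigma J (\<lambda>k. J - {k}).
      - (wsign k J * wsign l (J - {k}) * A k l * X (J - {k} - {l})))"
  proof -
    have "wsign l J * wsign k (J - {l}) * A k l * X (J - {l} - {k}) =
        - (wsign k J * wsign l (J - {k}) * A k l * X (J - {k} - {l}))"
      if "k \<in> J" "l \<in> J" "l \<noteq> k" for k l
    proof -
      have "J - {l} - {k} = J - {k} - {l}"
        by auto
      then show ?thesis
        using wsign_swap[OF True, of k l] that by simp
    qed
    then show ?thesis
      by (intro sum.cong) auto
  qed
  also have "\<dots> = - wedge2 A X J"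
    unfolding wedge2_def using True by (subst sum.Sigma) (auto simp: sum_negf case_prod_unfold)
  finally show ?thesis .
qed (simp add: wedge2_def)

lemma wedge_wedge: "wedge u (wedge v X) J = wedge2 (\<lambda>k l. u k * v l) X J"
  by (simp add: wedge_def wedge2_def sum_distrib_left mult_ac)

lemma wedge_anticommute: "wedge u (wedge v X) J = - wedge v (wedge u X) J"
  using wedge2_transpose[of "\<lambda>k l. v k * u l" X J] by (simp add: wedge_wedge mult.commute)

lemma wedge_self [simp]: "wedge u (wedge u X) J = 0"
  using wedge_anticommute[of u u X J] by simp

lemma wedge_add_left: "wedge (\<lambda>k. u k + v k) X J = wedge u X J + wedge v X J"
  by (simp add: wedge_def algebra_simps sum.distrib)

lemma wedge_diff_left: "wedge (\<lambda>k. u k - v k) X J = wedge u X J - wedge v X J"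
  by (simp add: wedge_def algebra_simps sum_subtractf)

lemma wedge_scale_left: "wedge (\<lambda>k. c * u k) X J = c * wedge u X J"
  by (simp add: wedge_def sum_distrib_left mult_ac)

lemma wedge_sum_left: "wedge (\<lambda>k. \<Sum>a\<in>A. u a k) X J = (\<Sum>a\<in>A. wedge (u a) X J)"
  by (simp add: wedge_def sum_distrib_left sum_distrib_right sum.swap[of _ A J] mult_ac)

lemma wedge_add_right: "wedge u (\<lambda>J. X J + Y J) J = wedge u X J + wedge u Y J"
  by (simp add: wedge_def algebra_simps sum.distrib)

lemma wedge_scale_right: "wedge u (\<lambda>J. c * X J) J = c * wedge u X J"
  by (simp add: wedge_def sum_distrib_left mult_ac)

lemma wedge_zero_right [simp]: "wedge u (\<lambda>J. 0) J = 0"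
  by (simp add: wedge_def)

lemma wedge_sum_right: "wedge u (\<lambda>J. \<Sum>a\<in>A. X a J) J = (\<Sum>a\<in>A. wedge u (X a) J)"
  by (simp add: wedge_def sum_distrib_left sum.swap[of _ A J] mult_ac)

lemma wedge_card:
  assumes "finite J"
  shows "wedge u (\<lambda>J. real (card J) * X J) J = (real (card J) - 1) * wedge u X J"
proof -
  have "real (card (J - {k})) = real (card J) - 1" if "k \<in> J" for k
    using card.remove[OF assms that] by simp
  then show ?thesis
    by (simp add: wedge_def sum_distrib_left mult_ac)
qed

lemma wedge2_add: "wedge2 (\<lambda>k l. A k l + B k l) X J = wedge2 A X J + wedge2 B X J"
  by (simp add: wedge2_def algebra_simps sum.distrib)

lemma wedge2_diff: "wedge2 (\<lambda>k l. A k l - B k l) X J = wedge2 A X J - wedge2 B X J"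
  by (simp add: wedge2_def algebra_simps sum_subtractf)

lemma wedge2_zero [simp]: "wedge2 (\<lambda>k l. 0) X J = 0"
  by (simp add: wedge2_def)

lemma wedge2_sum: "wedge2 (\<lambda>k l. \<Sum>a\<in>I. A a k l) X J = (\<Sum>a\<in>I. wedge2 (A a) X J)"
  by (induction I rule: infinite_finite_induct) (simp_all add: wedge2_add)

text \<open>The product \<open>(1 + p N) \<and> ... \<and> (1 + p 1)\<close>. Its part of even degree is the exponential of the
  2-form \<open>pform p N\<close>, and its part of odd degree is \<open>psum p N\<close> times that.\<close>

fun chain_sum :: "(nat \<Rightarrow> nat \<Rightarrow> real) \<Rightarrow> nat \<Rightarrow> nat set \<Rightarrow> real" where
  "chain_sum p 0 = vacuum"
| "chain_sum p (Suc N) = (\<lambda>J. chain_sum p N J + wedge (p (Suc N)) (chain_sum p N) J)"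

definition psum :: "(nat \<Rightarrow> nat \<Rightarrow> real) \<Rightarrow> nat \<Rightarrow> nat \<Rightarrow> real" where
  "psum p N k = (\<Sum>i=1..N. p i k)"

definition pform :: "(nat \<Rightarrow> nat \<Rightarrow> real) \<Rightarrow> nat \<Rightarrow> nat \<Rightarrow> nat \<Rightarrow> real" where
  "pform p N k l = (\<Sum>i=1..N. p i k * psum p (i - 1) l - p i l * psum p (i - 1) k)"

lemma psum_0 [simp]: "psum p 0 = (\<lambda>k. 0)"
  by (simp add: psum_def fun_eq_iff)

lemma psum_Suc: "psum p (Suc N) = (\<lambda>k. psum p N k + p (Suc N) k)"
  by (simp add: psum_def fun_eq_iff)

lemma pform_0 [simp]: "pform p 0 = (\<lambda>k l. 0)"
  by (simp add: pform_def fun_eq_iff)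

lemma pform_Suc: "pform p (Suc N) =
    (\<lambda>k l. pform p N k l + (p (Suc N) k * psum p N l - p (Suc N) l * psum p N k))"
  by (simp add: pform_def fun_eq_iff)

text \<open>The product of the factors \<open>1 + p i \<and> psum p (i - 1)\<close>. Each is the
  exponential of a 2-form of square zero, and 2-forms commute.\<close>

fun even_chain_sum :: "(nat \<Rightarrow> nat \<Rightarrow> real) \<Rightarrow> nat \<Rightarrow> nat set \<Rightarrow> real" where
  "even_chain_sum p 0 = vacuum"
| "even_chain_sum p (Suc N) =
     (\<lambda>J. even_chain_sum p N J + wedge (p (Suc N)) (wedge (psum p N) (even_chain_sum p N)) J)"

lemma wedge_zero_left [simp]: "wedge (\<lambda>k. 0) X J = 0"
  by (simp add: wedge_def)

text \<open>With \<open>s = psum p N\<close> and \<open>p = p (Suc N)\<close>, the identity is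
  \<open>(1 + p)(1 + s) = (1 + s + p)(1 + p s)\<close>: the cubic terms \<open>s p s\<close> and
  \<open>p p s\<close> vanish.\<close>

lemma chain_sum_even_chain_sum:
  "chain_sum p N = (\<lambda>J. even_chain_sum p N J + wedge (psum p N) (even_chain_sum p N) J)"
proof (induction N)
  case (Suc N)
  let ?E = "even_chain_sum p N" and ?s = "psum p N" and ?p = "p (Suc N)"
  have "wedge (psum p (Suc N)) (even_chain_sum p (Suc N)) J = wedge ?s ?E J + wedge ?p ?E J" for J
  proof -
    have *: "wedge ?s (wedge ?p (wedge ?s ?E)) J = 0"
    proof -
      have "wedge ?s (wedge ?s ?E) = (\<lambda>J. 0)"
        by (simp add: fun_eq_iff)
      then show ?thesis
        using wedge_anticommute[of ?s ?p "wedge ?s ?E" J] by simp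
    qed
    show ?thesis
      by (simp add: psum_Suc wedge_add_left wedge_add_right *)
  qed
  then show ?case
    by (simp add: Suc.IH fun_eq_iff wedge_add_right)
qed (simp add: fun_eq_iff)

lemma even_chain_sum_empty [simp]: "even_chain_sum p N {} = 1"
  by (induction N) (simp_all add: vacuum_def)

lemma even_chain_sum_odd: "odd (card J) \<Longrightarrow> even_chain_sum p N J = 0"
proof (induction N arbitrary: J)
  case (Suc N)
  have "wedge2 A (even_chain_sum p N) J = 0" for A
  proof -
    have "odd (card (J - {k} - {l}))" if "k \<in> J" "l \<in> J - {k}" for k l
    proof -
      have "finite J"
        using Suc.prems card.infinite by fastforce
      then have "card J = Suc (Suc (card (J - {k} - {l})))"
        using that by (metis card.remove finite_Diff)
      then show ?thesis
        using Suc.prems by simp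
    qed
    then show ?thesis
      unfolding wedge2_def by (intro sum.neutral ballI) (simp add: Suc.IH)
  qed
  then show ?case
    using Suc by (simp add: wedge_wedge)
qed (auto simp: vacuum_def)

lemma wedge_even_chain_sum_even: "even (card J) \<Longrightarrow> wedge v (even_chain_sum p N) J = 0"
proof (cases "finite J")
  case True
  assume "even (card J)"
  then have "odd (card (J - {k}))" if "k \<in> J" for k
    using that True by (metis card.remove even_Suc)
  then show ?thesis
    unfolding wedge_def by (intro sum.neutral ballI) (simp add: even_chain_sum_odd)
qed (simp add: wedge_def)

lemma wedge_minus_right: "wedge u (\<lambda>J. - X J) J = - wedge u X J"
  by (simp add: wedge_def sum_negf)

lemma wedge_pair_commute:
  "wedge u (wedge v (wedge a (wedge b X))) J = wedge a (wedge b (wedge u (wedge v X))) J"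
proof -
  have swap: "wedge x (wedge y Z) = (\<lambda>J. - wedge y (wedge x Z) J)" for x y Z
    by (rule ext) (rule wedge_anticommute)
  have "wedge u (wedge v (wedge a (wedge b X))) J = wedge a (wedge u (wedge v (wedge b X))) J"
    by (simp add: swap[of v a] swap[of u a] wedge_minus_right)
  also have "wedge u (wedge v (wedge b X)) = wedge b (wedge u (wedge v X))"
    by (simp add: swap[of v b] swap[of u b] wedge_minus_right fun_eq_iff)
  finally show ?thesis .
qed

text \<open>The expansion of a Pfaffian along all of its rows at once.\<close>

lemma card_even_chain_sum:
  assumes "finite J"
  shows "real (card J) * even_chain_sum p N J = wedge2 (pform p N) (even_chain_sum p N) J"
proof -
  define W where "W N X J = (\<Sum>i=1..N. wedge (p i) (wedge (psum p (i - 1)) X) J)" for N X J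
  have W2: "2 * W N X J = wedge2 (pform p N) X J" for N X J
  proof -
    have "wedge2 (pform p N) X J = (\<Sum>i=1..N. wedge2 (\<lambda>k l. p i k * psum p (i - 1) l) X J
        - wedge2 (\<lambda>k l. p i l * psum p (i - 1) k) X J)"
      by (simp add: pform_def[abs_def] wedge2_sum wedge2_diff)
    also have "\<dots> = (\<Sum>i=1..N. 2 * wedge2 (\<lambda>k l. p i k * psum p (i - 1) l) X J)"
    proof (intro sum.cong refl)
      fix i
      show "wedge2 (\<lambda>k l. p i k * psum p (i - 1) l) X J - wedge2 (\<lambda>k l. p i l * psum p (i - 1) k) X J =
          2 * wedge2 (\<lambda>k l. p i k * psum p (i - 1) l) X J"
        using wedge2_transpose[of "\<lambda>k l. p i k * psum p (i - 1) l" X J] by simp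
    qed
    finally show ?thesis
      by (simp add: W_def wedge_wedge sum_distrib_left)
  qed
  have W_commute: "W N (wedge u (wedge v X)) J = wedge u (wedge v (W N X)) J" for N u v X J
    unfolding W_def by (simp add: wedge_sum_right[abs_def] wedge_pair_commute[of _ _ u v])
  \<comment> \<open>The degree \<open>card J\<close> acts as a derivation. On each factor, whose
    nonconstant term has degree 2, it brings down twice the 2-form, and 2-forms commute with
    everything that stands before them.\<close>
  have "real (card J) * even_chain_sum p N J = 2 * W N (even_chain_sum p N) J" if "finite J" for J N
    using that
  proof (induction N arbitrary: J)
    case 0
    then show ?case
      by (simp add: W_def vacuum_def)
  next
    case (Suc N)
    let ?E = "even_chain_sum p N" and ?s = "psum p N" and ?p = "p (Suc N)"
    have wedge_cong: "wedge u X J = wedge u Y J" if "\<And>J. finite J \<Longrightarrow> X J = Y J" "finite J" for u X Y J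
      using that by (simp add: wedge_def)
    have card_wedge: "real (card J) * wedge u X J = wedge u X J + wedge u (\<lambda>J. real (card J) * X J) J"
      if "finite J" for u X J
      using wedge_card[OF that, of u X] by (simp add: algebra_simps)
    have s: "real (card J) * wedge ?s ?E J = wedge ?s ?E J + 2 * wedge ?s (W N ?E) J"
      if "finite J" for J
    proof -
      have "wedge ?s (\<lambda>J. real (card J) * ?E J) J = wedge ?s (\<lambda>J. 2 * W N ?E J) J"
        by (rule wedge_cong) (use Suc.IH that in auto)
      then show ?thesis
        using card_wedge[OF that, of ?s ?E] by (simp add: wedge_scale_right)
    qed
    have "wedge ?p (\<lambda>J. real (card J) * wedge ?s ?E J) J =
        wedge ?p (\<lambda>J. wedge ?s ?E J + 2 * wedge ?s (W N ?E) J) J"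
      by (rule wedge_cong) (use s Suc.prems in auto)
    then have "real (card J) * wedge ?p (wedge ?s ?E) J =
        2 * wedge ?p (wedge ?s ?E) J + 2 * wedge ?p (wedge ?s (W N ?E)) J"
      using card_wedge[OF Suc.prems, of ?p "wedge ?s ?E"]
      by (simp add: wedge_add_right wedge_scale_right)
    moreover have "W (Suc N) (even_chain_sum p (Suc N)) J =
        W N ?E J + W N (wedge ?p (wedge ?s ?E)) J + wedge ?p (wedge ?s ?E) J"
    proof -
      \<comment> \<open>The newest 2-form has square zero, so it contributes only through the old
        product \<open>?E\<close>.\<close>
      have "wedge ?p (wedge ?s (wedge ?p (wedge ?s ?E))) J = 0"
      proof -
        have "wedge ?s (wedge ?p (wedge ?s ?E)) = (\<lambda>J. 0)"
          by (subst wedge_anticommute[abs_def])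
            (simp add: fun_eq_iff wedge_anticommute[of ?s ?p] wedge_minus_right
              wedge_self[abs_def])
        then show ?thesis by simp
      qed
      then show ?thesis
        by (simp add: W_def wedge_add_right[abs_def] sum.distrib)
    qed
    ultimately show ?case
      using Suc by (simp add: algebra_simps W_commute)
  qed
  then show ?thesis
    using assms W2 by simp
qed

text \<open>Each term of the expansion is one entry times a Pfaffian with both of its indices
  removed, so bounds that are additive over the indices are inherited by induction on
  \<open>card J\<close>. The function \<open>y\<close> is the variable in which the dependence on
  \<open>N\<close> is polynomial: \<open>real\<close> without signs, \<open>tau\<close> with
  them.\<close>

lemma even_chain_sum_poly:
  fixes c :: real
  assumes "finite J"
    and "\<And>k l N. k \<in> J \<Longrightarrow> l \<in> J \<Longrightarrow> poly (Om k l) (y N) = pform p N k l"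
    and "\<And>k l. k \<in> J \<Longrightarrow> l \<in> J \<Longrightarrow> k \<noteq> l \<Longrightarrow> degree (Om k l) \<le> d k + d l"
    and "\<And>k l. k \<in> J \<Longrightarrow> l \<in> J \<Longrightarrow> k \<noteq> l \<Longrightarrow> [:- c, 1:] ^ (w k + w l) dvd Om k l"
  shows "\<exists>P. (\<forall>N. poly P (y N) = even_chain_sum p N J) \<and> degree P \<le> sum d J
    \<and> [:- c, 1:] ^ sum w J dvd P"
  using assms
proof (induction "card J" arbitrary: J rule: less_induct)
  case less
  show ?case
  proof (cases "J = {}")
    case True
    then show ?thesis
      by (intro exI[of _ 1]) simp
  next
    case False
    have smaller: "\<exists>P. (\<forall>N. poly P (y N) = even_chain_sum p N (J - {k} - {l}))
        \<and> degree P \<le> sum d (J - {k} - {l}) \<and> [:- c, 1:] ^ sum w (J - {k} - {l}) dvd P"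
      if "k \<in> J" for k l
    proof (rule less.hyps)
      show "card (J - {k} - {l}) < card J"
        using that less.prems(1) by (intro psubset_card_mono) auto
    qed (use less.prems in auto)
    then have "\<forall>k. \<forall>l. \<exists>P. k \<in> J \<longrightarrow> (\<forall>N. poly P (y N) = even_chain_sum p N (J - {k} - {l}))
        \<and> degree P \<le> sum d (J - {k} - {l}) \<and> [:- c, 1:] ^ sum w (J - {k} - {l}) dvd P"
      by blast
    then obtain P where P: "\<And>k l N. k \<in> J \<Longrightarrow> poly (P k l) (y N) = even_chain_sum p N (J - {k} - {l})"
        "\<And>k l. k \<in> J \<Longrightarrow> degree (P k l) \<le> sum d (J - {k} - {l})"
        "\<And>k l. k \<in> J \<Longrightarrow> [:- c, 1:] ^ sum w (J - {k} - {l}) dvd P k l"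
      by (simp only: choice_iff) blast
    define R where "R = (\<Sum>k\<in>J. \<Sum>l\<in>J - {k}.
        smult (wsign k J * wsign l (J - {k})) (Om k l * P k l))"
    have split_sum: "sum f J = f k + f l + sum f (J - {k} - {l})" if "k \<in> J" "l \<in> J - {k}"
      for f :: "nat \<Rightarrow> nat" and k l
      using that less.prems(1) sum.remove[of J k f] sum.remove[of "J - {k}" l f] by simp
    have "degree (smult a (Om k l * P k l)) \<le> sum d J" if "k \<in> J" "l \<in> J - {k}" for a k l
    proof -
      have "degree (smult a (Om k l * P k l)) \<le> degree (Om k l) + degree (P k l)"
        using degree_smult_le degree_mult_le by (rule order_trans)
      also have "\<dots> \<le> (d k + d l) + sum d (J - {k} - {l})"
        using that P(2) less.prems(3) by (intro add_mono) auto
      finally show ?thesis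
        using split_sum[OF that] by simp
    qed
    then have "degree R \<le> sum d J"
      unfolding R_def using less.prems(1) by (intro degree_sum_le) (auto simp del: degree_smult_eq)
    moreover have "[:- c, 1:] ^ sum w J dvd R"
    proof -
      have "[:- c, 1:] ^ sum w J dvd Om k l * P k l" if "k \<in> J" "l \<in> J - {k}" for k l
        unfolding split_sum[OF that] power_add[of _ "w k + w l"]
        using that P(3) less.prems(4) by (intro mult_dvd_mono) auto
      then show ?thesis
        unfolding R_def by (intro dvd_sum dvd_smult)
    qed
    moreover have "poly R (y N) = real (card J) * even_chain_sum p N J" for N
      unfolding R_def card_even_chain_sum[OF less.prems(1)] wedge2_def poly_sum
      by (intro sum.cong refl) (simp add: P(1) less.prems(2))
    ultimately show ?thesis
      using False less.prems(1)
      by (intro exI[of _ "smult (1 / real (card J)) R"]) (auto intro: dvd_smult)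
  qed
qed

text \<open>Divisibility of the entries of a skew-symmetric matrix by powers of \<open>x - c\<close> adds up to
  divisibility of its Pfaffian, and likewise for the degrees.\<close>

lemma chain_sum_poly:
  fixes c :: real
  assumes fin: "finite J"
    and F: "\<And>k N. k \<in> J \<Longrightarrow> poly (F k) (y N) = psum p N k"
    and Om: "\<And>k l N. k \<in> J \<Longrightarrow> l \<in> J \<Longrightarrow> poly (Om k l) (y N) = pform p N k l"
    and deg: "\<And>k. k \<in> J \<Longrightarrow> degree (F k) \<le> d k"
      "\<And>k l. k \<in> J \<Longrightarrow> l \<in> J \<Longrightarrow> k \<noteq> l \<Longrightarrow> degree (Om k l) \<le> d k + d l"
    and dvd: "\<And>k. k \<in> J \<Longrightarrow> [:- c, 1:] ^ w k dvd F k"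
      "\<And>k l. k \<in> J \<Longrightarrow> l \<in> J \<Longrightarrow> k \<noteq> l \<Longrightarrow> [:- c, 1:] ^ (w k + w l) dvd Om k l"
  shows "\<exists>P. (\<forall>N. poly P (y N) = chain_sum p N J) \<and> degree P \<le> sum d J
    \<and> [:- c, 1:] ^ sum w J dvd P"
proof (cases "even (card J)")
  case True
  then show ?thesis
    using even_chain_sum_poly[OF fin Om deg(2) dvd(2)]
    by (simp add: chain_sum_even_chain_sum wedge_even_chain_sum_even)
next
  case False
  \<comment> \<open>For an odd number of indices the border \<open>psum p N\<close> is expanded
    once. It behaves like a row of an additional index for which \<open>d\<close> and
    \<open>w\<close> are 0.\<close>
  have "\<exists>P. (\<forall>N. poly P (y N) = even_chain_sum p N (J - {k}))
      \<and> degree P \<le> sum d (J - {k}) \<and> [:- c, 1:] ^ sum w (J - {k}) dvd P" for k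
    by (rule even_chain_sum_poly[where Om = Om]) (use fin Om deg(2) dvd(2) in auto)
  then obtain P where P: "\<And>k N. poly (P k) (y N) = even_chain_sum p N (J - {k})"
      "\<And>k. degree (P k) \<le> sum d (J - {k})"
      "\<And>k. [:- c, 1:] ^ sum w (J - {k}) dvd P k"
    by metis
  define R where "R = (\<Sum>k\<in>J. smult (wsign k J) (F k * P k))"
  have split_sum: "sum f J = f k + sum f (J - {k})" if "k \<in> J" for f :: "nat \<Rightarrow> nat" and k
    using that fin by (rule sum.remove[rotated])
  have "degree (smult a (F k * P k)) \<le> sum d J" if "k \<in> J" for a k
  proof -
    have "degree (smult a (F k * P k)) \<le> degree (F k) + degree (P k)"
      using degree_smult_le degree_mult_le by (rule order_trans)
    also have "\<dots> \<le> d k + sum d (J - {k})"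
      using that P(2) deg(1) by (intro add_mono) auto
    finally show ?thesis
      using split_sum[OF that] by simp
  qed
  then have "degree R \<le> sum d J"
    unfolding R_def using fin by (intro degree_sum_le) (auto simp del: degree_smult_eq)
  moreover have "[:- c, 1:] ^ sum w J dvd R"
  proof -
    have "[:- c, 1:] ^ sum w J dvd F k * P k" if "k \<in> J" for k
      unfolding split_sum[OF that] power_add
      using that P(3) dvd(1) by (intro mult_dvd_mono) auto
    then show ?thesis
      unfolding R_def by (intro dvd_sum dvd_smult)
  qed
  moreover have "poly R (y N) = chain_sum p N J" for N
    using False by (simp add: R_def chain_sum_even_chain_sum even_chain_sum_odd wedge_def poly_sum
        P(1) F mult_ac)
  ultimately show ?thesis
    by blast
qed

section \<open>Branching of symplectic tableaux\<close>

text \<open>Letters are replaced by their ranks, all below \<open>b\<close>, and rows may be empty, so that the number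
  of rows does not change when letters are removed.\<close>

definition nat_tableaux :: "nat \<Rightarrow> nat list \<Rightarrow> nat list list set" where
  "nat_tableaux b la = {T. map length T = la \<and> (\<forall>R \<in> set T. sorted R) \<and>
     (\<forall>i < length T. \<forall>x \<in> set (T ! i). 2 * i + 2 \<le> x \<and> x < b) \<and>
     (\<forall>i j. Suc i < length T \<longrightarrow> j < length (T ! Suc i) \<longrightarrow> T ! i ! j < T ! Suc i ! j)}"

definition head0 :: "nat list \<Rightarrow> nat" where
  "head0 la = (case la of [] \<Rightarrow> 0 | a # _ \<Rightarrow> a)"

lemma head0_simps [simp]: "head0 [] = 0" "head0 (a # la) = a"
  by (simp_all add: head0_def)

text \<open>The shapes that remain when a horizontal strip is taken away from \<open>la\<close>. The
  last part has no successor, and \<open>head0 [] = 0\<close> supplies its lower bound.\<close>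

primrec interlacing :: "nat list \<Rightarrow> nat list set" where
  "interlacing [] = {[]}"
| "interlacing (a # la) = (\<lambda>(m, mu). m # mu) ` ({head0 la..a} \<times> interlacing la)"

lemma finite_interlacing: "finite (interlacing la)"
  by (induction la) auto

lemma mem_interlacing_iff:
  "mu \<in> interlacing la \<longleftrightarrow> length mu = length la \<and>
     (\<forall>i < length la. mu ! i \<le> la ! i \<and> (Suc i < length la \<longrightarrow> la ! Suc i \<le> mu ! i))"
proof (induction la arbitrary: mu)
  case (Cons a la)
  show ?case
  proof (cases mu)
    case (Cons m ms)
    have "head0 la \<le> m \<longleftrightarrow> (Suc 0 < length (a # la) \<longrightarrow> (a # la) ! Suc 0 \<le> m)"
      by (cases la) auto
    then show ?thesis
      using Cons.IH[of ms] by (auto simp: Cons image_iff less_Suc_eq_0_disj)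
  qed auto
qed auto

lemma sorted_interlacing:
  assumes "mu \<in> interlacing la"
  shows "sorted_wrt (\<ge>) mu" "length mu = length la"
proof -
  show len: "length mu = length la"
    using assms by (simp add: mem_interlacing_iff)
  have "mu ! Suc i \<le> mu ! i" if "Suc i < length mu" for i
    using assms that len by (auto simp: mem_interlacing_iff intro: order_trans[of _ "la ! Suc i"])
  then show "sorted_wrt (\<ge>) mu"
    by (auto simp: sorted_wrt_iff_nth_Suc_transp transp_on_def)
qed

lemma finite_nat_tableaux: "finite (nat_tableaux b la)"
proof -
  let ?R = "{R. set R \<subseteq> {..<b} \<and> length R \<le> sum_list la}"
  have "nat_tableaux b la \<subseteq> {T. set T \<subseteq> ?R \<and> length T = length la}"
    by (force simp: nat_tableaux_def in_set_conv_nth intro: member_le_sum_list)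
  moreover have "finite {T. set T \<subseteq> ?R \<and> length T = length la}"
    by (intro finite_lists_length_eq finite_lists_length_le) simp
  ultimately show ?thesis
    by (rule finite_subset)
qed

lemma sorted_split_top:
  fixes R :: "nat list"
  assumes "sorted R" "\<And>x. x \<in> set R \<Longrightarrow> x < Suc b"
  shows "R = filter (\<lambda>x. x < b) R @ replicate (length R - length (filter (\<lambda>x. x < b) R)) b"
  using assms
proof (induction R)
  case (Cons x R)
  show ?case
  proof (cases "x < b")
    case False
    then have "\<forall>y \<in> set (x # R). y = b"
      using Cons.prems by (force simp: less_Suc_eq)
    moreover from this have "filter (\<lambda>x. x < b) (x # R) = []"
      by (auto simp: filter_empty_conv)
    ultimately show ?thesis
      by (simp add: replicate_length_same[symmetric])
  qed (use Cons in auto)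
qed simp

lemma nth_less_top_iff:
  fixes R :: "nat list"
  assumes "sorted R" "\<And>x. x \<in> set R \<Longrightarrow> x < Suc b" "j < length R"
  shows "R ! j < b \<longleftrightarrow> j < length (filter (\<lambda>x. x < b) R)"
    and "j < length (filter (\<lambda>x. x < b) R) \<Longrightarrow> filter (\<lambda>x. x < b) R ! j = R ! j"
proof -
  let ?S = "filter (\<lambda>x. x < b) R"
  have R: "R = ?S @ replicate (length R - length ?S) b"
    using sorted_split_top[OF assms(1,2)] .
  have eq: "R ! j = (if j < length ?S then ?S ! j else b)"
    using assms(3) by (subst R) (auto simp: nth_append)
  show "R ! j < b \<longleftrightarrow> j < length ?S"
    using eq nth_mem[of j ?S] by auto
  show "?S ! j = R ! j" if "j < length ?S"
    using eq that by simp
qed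

text \<open>Copies of the largest letter \<open>b\<close> end their rows, and strict columns make
  their cells a horizontal strip. The bound \<open>2 * length la \<le> b\<close> ensures that
  \<open>b\<close> respects the lower bound of every row, so any such strip can be filled
  again.\<close>

lemma card_nat_tableaux_Suc:
  assumes "sorted_wrt (\<ge>) la" and "2 * length la \<le> b"
  shows "card (nat_tableaux (Suc b) la) = (\<Sum>mu \<in> interlacing la. card (nat_tableaux b mu))"
proof -
  define restr where "restr = map (filter (\<lambda>x. x < b))"
  define ext where "ext = (\<lambda>T. map (\<lambda>i. T ! i @ replicate (la ! i - length (T ! i)) b) [0..<length la])"
  have desc: "la ! Suc i \<le> la ! i" if "Suc i < length la" for i
    using sorted_wrt_nth_less[OF assms(1), of i "Suc i"] that by simp
  have "bij_betw restr (nat_tableaux (Suc b) la) (\<Union>mu \<in> interlacing la. nat_tableaux b mu)"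
  proof (rule bij_betw_byWitness[where f' = ext])
    show "\<forall>T \<in> nat_tableaux (Suc b) la. ext (restr T) = T"
    proof
      fix T assume T: "T \<in> nat_tableaux (Suc b) la"
      then have len: "length T = length la" "\<And>i. i < length T \<Longrightarrow> length (T ! i) = la ! i"
        by (auto simp: nat_tableaux_def)
      show "ext (restr T) = T"
      proof (rule nth_equalityI)
        fix i assume "i < length (ext (restr T))"
        then have "i < length T"
          by (simp add: ext_def len)
        then show "ext (restr T) ! i = T ! i"
          using T len sorted_split_top[of "T ! i" b]
          by (auto simp: ext_def restr_def nat_tableaux_def)
      qed (simp add: ext_def len)
    qed
    show "\<forall>T \<in> (\<Union>mu \<in> interlacing la. nat_tableaux b mu). restr (ext T) = T"
    proof
      fix T assume "T \<in> (\<Union>mu \<in> interlacing la. nat_tableaux b mu)"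
      then obtain mu where mu: "mu \<in> interlacing la" "T \<in> nat_tableaux b mu"
        by blast
      then have len: "length T = length la"
        by (auto simp: nat_tableaux_def mem_interlacing_iff)
      show "restr (ext T) = T"
      proof (rule nth_equalityI)
        fix i assume "i < length (restr (ext T))"
        then have "i < length T"
          by (simp add: ext_def restr_def len)
        then show "restr (ext T) ! i = T ! i"
          using mu len by (auto simp: ext_def restr_def nat_tableaux_def filter_id_conv)
      qed (simp add: ext_def restr_def len)
    qed
    show "restr ` nat_tableaux (Suc b) la \<subseteq> (\<Union>mu \<in> interlacing la. nat_tableaux b mu)"
    proof clarify
      fix T assume T: "T \<in> nat_tableaux (Suc b) la"
      then have len: "length T = length la" "\<And>i. i < length T \<Longrightarrow> length (T ! i) = la ! i"
        by (auto simp: nat_tableaux_def)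
      have row: "sorted (T ! i)" "\<And>x. x \<in> set (T ! i) \<Longrightarrow> x < Suc b" if "i < length T" for i
        using T that by (auto simp: nat_tableaux_def)
      have strict: "T ! i ! j < T ! Suc i ! j" if "Suc i < length T" "j < length (T ! Suc i)" for i j
        using T that by (auto simp: nat_tableaux_def)
      have top: "T ! i ! j < b \<longleftrightarrow> j < length (filter (\<lambda>x. x < b) (T ! i))"
        "j < length (filter (\<lambda>x. x < b) (T ! i)) \<Longrightarrow> filter (\<lambda>x. x < b) (T ! i) ! j = T ! i ! j"
        if "i < length T" "j < length (T ! i)" for i j
        by (rule nth_less_top_iff; use that row in blast)+
      let ?mu = "map length (restr T)"
      \<comment> \<open>Otherwise the entry of row \<open>i\<close> in column \<open>?j\<close> is
        at least \<open>b\<close>, which leaves no admissible larger entry below it.\<close>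
      have "la ! Suc i \<le> length (filter (\<lambda>x. x < b) (T ! i))" if i: "Suc i < length la" for i
      proof (rule ccontr)
        let ?j = "length (filter (\<lambda>x. x < b) (T ! i))"
        assume "\<not> la ! Suc i \<le> ?j"
        then have j: "?j < length (T ! Suc i)" "?j < length (T ! i)"
          using i len desc[OF i] by auto
        then have "\<not> T ! i ! ?j < b"
          using top(1)[of i ?j] i len by simp
        moreover have "T ! Suc i ! ?j < Suc b"
          using j row(2)[of "Suc i" "T ! Suc i ! ?j"] i len by simp
        ultimately show False
          using strict[of i ?j] i len j by auto
      qed
      then have "?mu \<in> interlacing la"
        using len by (auto simp: mem_interlacing_iff restr_def intro: order_trans[OF length_filter_le])
      moreover have "restr T \<in> nat_tableaux b ?mu"
      proof -
        have "filter (\<lambda>x. x < b) (T ! i) ! j < filter (\<lambda>x. x < b) (T ! Suc i) ! j"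
          if i: "Suc i < length T" and j: "j < length (filter (\<lambda>x. x < b) (T ! Suc i))" for i j
        proof -
          have j': "j < length (T ! Suc i)"
            using j length_filter_le by (rule less_le_trans)
          have less: "T ! i ! j < T ! Suc i ! j"
            using strict i j' by simp
          have ji: "j < length (T ! i)"
            using j' desc[of i] i len by simp
          have "T ! Suc i ! j < b"
            using top(1)[of "Suc i" j] i j j' by simp
          then have "j < length (filter (\<lambda>x. x < b) (T ! i))"
            using less top(1)[of i j] i ji by simp
          then show ?thesis
            using less top(2)[of i j] top(2)[of "Suc i" j] i ji j j' by simp
        qed
        then show ?thesis
          using T by (auto simp: nat_tableaux_def restr_def sorted_wrt_filter)
      qed
      ultimately show "restr T \<in> (\<Union>mu \<in> interlacing la. nat_tableaux b mu)"
        by blast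
    qed
    show "ext ` (\<Union>mu \<in> interlacing la. nat_tableaux b mu) \<subseteq> nat_tableaux (Suc b) la"
    proof clarify
      fix T mu assume mu: "mu \<in> interlacing la" and T: "T \<in> nat_tableaux b mu"
      then have len: "length T = length la" "\<And>i. i < length T \<Longrightarrow> length (T ! i) = mu ! i"
        by (auto simp: nat_tableaux_def mem_interlacing_iff)
      have bounds: "2 * i + 2 \<le> x \<and> x < b" if "i < length T" "x \<in> set (T ! i)" for i x
        using T that unfolding nat_tableaux_def by blast
      have strict: "T ! i ! j < T ! Suc i ! j" if "Suc i < length T" "j < length (T ! Suc i)" for i j
        using T that unfolding nat_tableaux_def by blast
      have sorted: "sorted (T ! i)" if "i < length T" for i
        using T that unfolding nat_tableaux_def by simp
      have le: "mu ! i \<le> la ! i" "Suc i < length la \<Longrightarrow> la ! Suc i \<le> mu ! i" if "i < length la" for i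
        using mu that by (auto simp: mem_interlacing_iff)
      have nth: "ext T ! i = T ! i @ replicate (la ! i - length (T ! i)) b" if "i < length la" for i
        using that by (simp add: ext_def)
      have len_ext: "length (ext T) = length la"
        by (simp add: ext_def)
      have "map length (ext T) = la"
        by (rule nth_equalityI) (auto simp: len_ext nth len le)
      moreover have "sorted R" if R: "R \<in> set (ext T)" for R
      proof -
        obtain i where "i < length la" "R = ext T ! i"
          using R by (auto simp: in_set_conv_nth len_ext)
        then show ?thesis
          using len bounds[of i] sorted[of i] by (fastforce simp: nth sorted_append intro: less_imp_le)
      qed
      moreover have "2 * i + 2 \<le> x \<and> x < Suc b" if "i < length la" "x \<in> set (ext T ! i)" for i x
        using that len bounds[of i x] assms(2) by (auto simp: nth less_Suc_eq)
      moreover have "ext T ! i ! j < ext T ! Suc i ! j"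
        if i: "Suc i < length la" and j: "j < length (ext T ! Suc i)" for i j
      proof -
        have ji: "j < length (T ! i)"
          using i j le[of i] le[of "Suc i"] len by (auto simp: nth)
        show ?thesis
        proof (cases "j < length (T ! Suc i)")
          case True
          then show ?thesis
            using strict[of i j] ji i len by (simp add: nth nth_append)
        next
          case False
          moreover have "T ! i ! j < b"
            using bounds[of i "T ! i ! j"] ji i len by simp
          ultimately show ?thesis
            using ji i j by (auto simp: nth nth_append)
        qed
      qed
      ultimately show "ext T \<in> nat_tableaux (Suc b) la"
        unfolding nat_tableaux_def mem_Collect_eq len_ext by blast
    qed
  qed
  then have "card (nat_tableaux (Suc b) la) = card (\<Union>mu \<in> interlacing la. nat_tableaux b mu)"
    by (rule bij_betw_same_card)
  also have "\<dots> = (\<Sum>mu \<in> interlacing la. card (nat_tableaux b mu))"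
    by (rule card_UN_disjoint)
      (simp_all add: finite_interlacing finite_nat_tableaux, auto simp: nat_tableaux_def)
  finally show ?thesis .
qed

text \<open>Interlacing with one part less, as between consecutive rows of a Gelfand-Tsetlin
  pattern.\<close>

primrec inner_interlacing :: "nat list \<Rightarrow> nat list set" where
  "inner_interlacing [] = {}"
| "inner_interlacing (a # la) = (if la = [] then {[]}
     else (\<lambda>(m, mu). m # mu) ` ({head0 la..a} \<times> inner_interlacing la))"

lemma inner_interlacing_iff: "mu \<noteq> [] \<Longrightarrow> nu \<in> inner_interlacing mu \<longleftrightarrow> nu @ [0] \<in> interlacing mu"
proof (induction mu arbitrary: nu)
  case (Cons m mu)
  then show ?case
    by (cases mu; cases nu) (auto simp: image_iff)
qed simp

lemma sum_interlacing_ends_0: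
  fixes f :: "nat list \<Rightarrow> 'a :: comm_monoid_add"
  assumes "mu \<noteq> []" "\<And>nu. nu \<in> interlacing mu \<Longrightarrow> last nu \<noteq> 0 \<Longrightarrow> f nu = 0"
  shows "sum f (interlacing mu) = (\<Sum>nu \<in> inner_interlacing mu. f (nu @ [0]))"
proof -
  have "(\<Sum>nu \<in> inner_interlacing mu. f (nu @ [0])) = sum f ((\<lambda>nu. nu @ [0]) ` inner_interlacing mu)"
    by (subst sum.reindex) (auto simp: inj_on_def)
  also have "\<dots> = sum f (interlacing mu)"
  proof (rule sum.mono_neutral_left)
    show "\<forall>nu \<in> interlacing mu - (\<lambda>nu. nu @ [0]) ` inner_interlacing mu. f nu = 0"
    proof
      fix nu assume nu: "nu \<in> interlacing mu - (\<lambda>nu. nu @ [0]) ` inner_interlacing mu"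
      then have "nu \<noteq> []"
        using sorted_interlacing(2)[of nu mu] assms(1) by auto
      then have "last nu \<noteq> 0"
        using nu assms(1) inner_interlacing_iff[of mu "butlast nu"]
        by (metis DiffD1 DiffD2 append_butlast_last_id image_eqI)
      then show "f nu = 0"
        using assms(2) nu by blast
    qed
  qed (use assms(1) in \<open>auto simp: finite_interlacing inner_interlacing_iff\<close>)
  finally show ?thesis ..
qed

text \<open>The last row has index \<open>length nu\<close>, so its entries would have rank at least
  \<open>2 * length nu + 2\<close>, which is the first rank excluded by the bound.\<close>

lemma nat_tableaux_drop_last_row:
  "nat_tableaux (2 * length nu + 2) (nu @ [a]) =
     (if a = 0 then (\<lambda>T. T @ [[]]) ` nat_tableaux (2 * length nu + 2) nu else {})"
proof -
  have "a = 0 \<and> (\<exists>S. T = S @ [[]] \<and> S \<in> nat_tableaux (2 * length nu + 2) nu)"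
    if T: "T \<in> nat_tableaux (2 * length nu + 2) (nu @ [a])" for T
  proof -
    have "map length T = nu @ [a]"
      using T by (simp add: nat_tableaux_def)
    then obtain S R where S: "T = S @ [R]" "map length S = nu" "length R = a"
      by (auto simp: map_eq_append_conv)
    then have len: "length S = length nu"
      by auto
    have "\<forall>i < length T. \<forall>x \<in> set (T ! i). 2 * i + 2 \<le> x \<and> x < 2 * length nu + 2"
      using T by (simp add: nat_tableaux_def)
    then have "\<forall>x \<in> set R. 2 * length nu + 2 \<le> x \<and> x < 2 * length nu + 2"
      using S(1) len by (auto simp: nth_append dest: spec[of _ "length nu"])
    then have "R = []"
      by (cases R) auto
    moreover have "S \<in> nat_tableaux (2 * length nu + 2) nu"
      using T S unfolding nat_tableaux_def mem_Collect_eq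
      by (auto simp: nth_append less_Suc_eq split: if_splits)
    ultimately show ?thesis
      using S by auto
  qed
  moreover have "S @ [[]] \<in> nat_tableaux (2 * length nu + 2) (nu @ [0])"
    if "S \<in> nat_tableaux (2 * length nu + 2) nu" for S
    using that by (auto simp: nat_tableaux_def nth_append less_Suc_eq)
  ultimately show ?thesis
    by auto
qed

text \<open>The ranks removed are \<open>2n + 3\<close> and \<open>2n + 2\<close>, the barred and
  the plain letter \<open>n + 1\<close>. Once both are gone, the symplectic condition leaves nothing
  for the last row; hence the second shape has one part less.\<close>

lemma card_nat_tableaux_rec:
  assumes "sorted_wrt (\<ge>) la" "length la = Suc n"
  shows "card (nat_tableaux (2 * Suc n + 2) la) =
    (\<Sum>mu \<in> interlacing la. \<Sum>nu \<in> inner_interlacing mu. card (nat_tableaux (2 * n + 2) nu))"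
proof -
  have "card (nat_tableaux (Suc (2 * n + 2)) mu) =
      (\<Sum>nu \<in> inner_interlacing mu. card (nat_tableaux (2 * n + 2) nu))"
    if mu: "mu \<in> interlacing la" for mu
  proof -
    have "length mu = Suc n"
      using sorted_interlacing(2)[OF mu] assms(2) by simp
    then have ne: "mu \<noteq> []"
      by auto
    have len: "length nu = Suc n" if "nu \<in> interlacing mu" for nu
      using sorted_interlacing(2)[OF that] \<open>length mu = Suc n\<close> by simp
    have "card (nat_tableaux (Suc (2 * n + 2)) mu) = (\<Sum>nu \<in> interlacing mu. card (nat_tableaux (2 * n + 2) nu))"
      using sorted_interlacing(1)[OF mu] \<open>length mu = Suc n\<close> by (intro card_nat_tableaux_Suc) auto
    also have "\<dots> = (\<Sum>nu \<in> inner_interlacing mu. card (nat_tableaux (2 * n + 2) (nu @ [0])))"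
    proof (rule sum_interlacing_ends_0[OF ne])
      fix nu assume nu: "nu \<in> interlacing mu" "last nu \<noteq> 0"
      then have "nu = butlast nu @ [last nu]" "length (butlast nu) = n"
        using len by (auto simp: length_0_conv[symmetric] simp del: length_0_conv)
      then show "card (nat_tableaux (2 * n + 2) nu) = 0"
        using nu(2) nat_tableaux_drop_last_row[of "butlast nu" "last nu"] by simp
    qed
    also have "\<dots> = (\<Sum>nu \<in> inner_interlacing mu. card (nat_tableaux (2 * n + 2) nu))"
    proof (intro sum.cong refl)
      fix nu assume "nu \<in> inner_interlacing mu"
      then have "length nu = n"
        using len[of "nu @ [0]"] inner_interlacing_iff[OF ne] by simp
      then show "card (nat_tableaux (2 * n + 2) (nu @ [0])) = card (nat_tableaux (2 * n + 2) nu)"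
        using nat_tableaux_drop_last_row[of nu 0] by (simp add: card_image inj_on_def)
    qed
    finally show ?thesis .
  qed
  moreover have "card (nat_tableaux (Suc (Suc (2 * n + 2))) la) =
      (\<Sum>mu \<in> interlacing la. card (nat_tableaux (Suc (2 * n + 2)) mu))"
    using assms by (intro card_nat_tableaux_Suc) auto
  ultimately show ?thesis
    by simp
qed

section \<open>Alternants\<close>

text \<open>For finite \<open>J\<close> this is the determinant of the \<open>p l k\<close> with
  rows \<open>ls\<close> and the columns \<open>J\<close> in decreasing order, expanded along its
  first row; it is 0 if the sizes differ.\<close>

primrec alt :: "(nat \<Rightarrow> nat \<Rightarrow> real) \<Rightarrow> nat list \<Rightarrow> nat set \<Rightarrow> real" where
  "alt p [] = vacuum"
| "alt p (l # ls) = wedge (p l) (alt p ls)"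

primrec stair :: "nat list \<Rightarrow> nat list" where
  "stair [] = []"
| "stair (a # la) = Suc (a + length la) # stair la"

lemma sum_interlacing_Cons:
  "(\<Sum>mu \<in> interlacing (a # la). f mu) = (\<Sum>m = head0 la..a. \<Sum>mu \<in> interlacing la. f (m # mu))"
  by (simp add: sum.cartesian_product sum.reindex inj_on_def o_def case_prod_unfold)

lemma sum_inner_interlacing_Cons:
  "la \<noteq> [] \<Longrightarrow> (\<Sum>nu \<in> inner_interlacing (a # la). f nu) =
     (\<Sum>m = head0 la..a. \<Sum>nu \<in> inner_interlacing la. f (m # nu))"
  by (simp add: sum.cartesian_product sum.reindex inj_on_def o_def case_prod_unfold)

lemma length_inner_interlacing:
  "mu \<noteq> [] \<Longrightarrow> nu \<in> inner_interlacing mu \<Longrightarrow> Suc (length nu) = length mu"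
  using sorted_interlacing(2)[of "nu @ [0]" mu] inner_interlacing_iff[of mu nu] by simp

lemma sorted_inner_interlacing:
  "mu \<noteq> [] \<Longrightarrow> nu \<in> inner_interlacing mu \<Longrightarrow> sorted_wrt (\<ge>) nu"
  using sorted_interlacing(1)[of "nu @ [0]" mu] inner_interlacing_iff[of mu nu]
  by (simp add: sorted_wrt_append)

lemma head0_le: "sorted_wrt (\<ge>) (a # la) \<Longrightarrow> head0 la \<le> a"
  by (cases la) auto

text \<open>For nonempty \<open>la\<close>, the number \<open>head0 la + length la\<close> is the
  head of \<open>stair la\<close>, so the row subtracted is the next one. For empty
  \<open>la\<close> it is 0, and the row \<open>p 0\<close> is zero.\<close>

lemma alt_stair_diff_head:
  assumes "la \<noteq> [] \<or> p 0 = (\<lambda>_. 0)"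
  shows "alt p (stair (a # la)) J =
    wedge (\<lambda>k. p (Suc (a + length la)) k - p (head0 la + length la) k) (alt p (stair la)) J"
  using assms by (cases la) (simp_all add: wedge_diff_left)

lemma telescope_shift:
  fixes f :: "nat \<Rightarrow> real"
  shows "h \<le> a \<Longrightarrow> f (Suc (a + L)) - f (h + L) = (\<Sum>m=h..a. f (Suc (m + L)) - f (m + L))"
  using sum_Suc_diff[of h a "\<lambda>m. f (m + L)"] by simp

text \<open>The difference of consecutive rows telescopes into unit steps \<open>e\<close>, and the
  last row telescopes down to \<open>p 0\<close>. By multilinearity one step is chosen in each row,
  and these choices are exactly the interlacing \<open>mu\<close>.\<close>

lemma alt_stair_interlacing:
  assumes "p 0 = (\<lambda>_. 0)" and e: "\<And>l k. e (Suc l) k = p (Suc l) k - p l k"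
    and "sorted_wrt (\<ge>) la"
  shows "alt p (stair la) J = (\<Sum>mu \<in> interlacing la. alt e (stair mu) J)"
  using assms(3)
proof (induction la arbitrary: J)
  case (Cons a la)
  let ?L = "length la"
  have "(\<lambda>k. p (Suc (a + ?L)) k - p (head0 la + ?L) k) = (\<lambda>k. \<Sum>m=head0 la..a. e (Suc (m + ?L)) k)"
    using telescope_shift[OF head0_le[OF Cons.prems], of "\<lambda>l. p l _"] by (simp add: e)
  then have "alt p (stair (a # la)) J =
      wedge (\<lambda>k. \<Sum>m=head0 la..a. e (Suc (m + ?L)) k) (alt p (stair la)) J"
    unfolding alt_stair_diff_head[of la p a J, OF disjI2[OF assms(1)]]
    by (rule arg_cong[where f = "\<lambda>w. wedge w (alt p (stair la)) J"])
  also have "alt p (stair la) = (\<lambda>J. \<Sum>mu \<in> interlacing la. alt e (stair mu) J)"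
    using Cons by (intro ext) simp
  also have "wedge (\<lambda>k. \<Sum>m=head0 la..a. e (Suc (m + ?L)) k) \<dots> J =
      (\<Sum>m=head0 la..a. \<Sum>mu \<in> interlacing la. wedge (e (Suc (m + ?L))) (alt e (stair mu)) J)"
    by (simp add: wedge_sum_left wedge_sum_right)
  also have "\<dots> = (\<Sum>mu \<in> interlacing (a # la). alt e (stair mu) J)"
    unfolding sum_interlacing_Cons
    by (intro sum.cong refl) (simp add: sorted_interlacing(2))
  finally show ?case .
qed simp

lemma wedge_insert_below:
  assumes "finite J" "\<And>k. k \<in> J \<Longrightarrow> s < k" "w s = 0"
  shows "wedge w X (insert s J) = wedge w (\<lambda>J. X (insert s J)) J"
proof -
  have "s \<notin> J"
    using assms(2) by blast
  then have "wedge w X (insert s J) = (\<Sum>k\<in>J. wsign k (insert s J) * w k * X (insert s J - {k}))"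
    using assms by (simp add: wedge_def)
  also have "\<dots> = wedge w (\<lambda>J. X (insert s J)) J"
    unfolding wedge_def
  proof (intro sum.cong refl)
    fix k assume k: "k \<in> J"
    then have "{x \<in> insert s J. k < x} = {x \<in> J. k < x}" "insert s J - {k} = insert s (J - {k})"
      using assms(2)[OF k] by auto
    then show "wsign k (insert s J) * w k * X (insert s J - {k}) =
        wsign k J * w k * X (insert s (J - {k}))"
      by (simp add: wsign_def)
  qed
  finally show ?thesis .
qed

text \<open>Column \<open>s\<close> is constant, so differences of rows vanish in it; only the last
  row, from which nothing is subtracted, keeps the entry \<open>c\<close>. Expansion along this
  column removes it together with the last row, and the other rows telescope.\<close>

lemma alt_stair_inner_interlacing:
  assumes "\<And>l. e (Suc l) s = c" and f: "\<And>l k. f (Suc l) k = e (Suc (Suc l)) k - e (Suc l) k"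
    and "mu \<noteq> []" "sorted_wrt (\<ge>) mu" "finite J" "\<And>k. k \<in> J \<Longrightarrow> s < k"
  shows "alt e (stair mu) (insert s J) = c * (\<Sum>nu \<in> inner_interlacing mu. alt f (stair nu) J)"
  using assms(3-)
proof (induction mu arbitrary: J)
  case (Cons a mu)
  show ?case
  proof (cases "mu = []")
    case True
    show ?thesis
    proof (cases "J = {}")
      case False
      have "s \<notin> J"
        using Cons.prems(4) by blast
      then have "vacuum (insert s J - {k}) = 0" for k
        using False by (auto simp: vacuum_def)
      then show ?thesis
        using True False by (simp add: wedge_def vacuum_def)
    next
      case J: True
      have "{x \<in> {s}. s < x} = {}"
        by auto
      then have "wsign s {s} = 1"
        unfolding wsign_def by (simp only: card.empty power_0)
      then show ?thesis
        using True J by (simp add: wedge_def vacuum_def assms(1))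
    qed
  next
    case False
    then obtain L where L: "length mu = Suc L"
      by (cases mu) auto
    let ?w = "\<lambda>k. \<Sum>m=head0 mu..a. f (Suc (m + L)) k"
    have "(\<lambda>k. e (Suc (a + length mu)) k - e (head0 mu + length mu) k) = ?w"
      using telescope_shift[OF head0_le[OF Cons.prems(2)], of "\<lambda>l. e l _" "Suc L"] by (simp add: f L)
    then have "alt e (stair (a # mu)) (insert s J) = wedge ?w (alt e (stair mu)) (insert s J)"
      unfolding alt_stair_diff_head[of mu e a "insert s J", OF disjI1[OF False]]
      by (rule arg_cong[where f = "\<lambda>w. wedge w (alt e (stair mu)) (insert s J)"])
    also have "\<dots> = wedge ?w (\<lambda>J. alt e (stair mu) (insert s J)) J"
      using Cons.prems by (intro wedge_insert_below) (auto simp: f assms(1))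
    also have "\<dots> = wedge ?w (\<lambda>J. c * (\<Sum>nu \<in> inner_interlacing mu. alt f (stair nu) J)) J"
    proof -
      have "alt e (stair mu) (insert s (J - {k})) =
          c * (\<Sum>nu \<in> inner_interlacing mu. alt f (stair nu) (J - {k}))" for k
        using Cons.prems False by (intro Cons.IH) auto
      then show ?thesis
        by (simp add: wedge_def)
    qed
    also have "\<dots> = c * (\<Sum>m=head0 mu..a. \<Sum>nu \<in> inner_interlacing mu.
        wedge (f (Suc (m + L))) (alt f (stair nu)) J)"
      by (simp add: wedge_sum_left wedge_sum_right wedge_scale_right sum_distrib_left)
    also have "\<dots> = c * (\<Sum>nu \<in> inner_interlacing (a # mu). alt f (stair nu) J)"
      unfolding sum_inner_interlacing_Cons[OF False]
      using L length_inner_interlacing[OF False]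
      by (intro arg_cong[of _ _ "\<lambda>x. c * x"] sum.cong refl) auto
    finally show ?thesis .
  qed
qed simp

section \<open>Differences of polynomials and the determinant of an odd family\<close>

lemma coeff_shift_top:
  fixes p :: "real poly"
  assumes "degree p \<le> n"
  shows "coeff (pcompose p [:a, 1:]) n = coeff p n"
proof (cases "degree p = n")
  case True
  then show ?thesis
    using lead_coeff_comp[of "[:a, 1:]" p] by (simp add: degree_pcompose)
next
  case False
  then show ?thesis
    using assms by (simp add: coeff_eq_0 degree_pcompose)
qed

text \<open>For \<open>p = c + x r\<close> the difference is \<open>x\<close> times the difference
  of \<open>r\<close>, plus \<open>r (x + 1)\<close>. A degree bound instead of the exact degree
  makes the induction uniform.\<close>

lemma forward_difference_top:
  fixes p :: "real poly"
  assumes "degree p \<le> Suc d"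
  shows "degree (pcompose p [:1, 1:] - p) \<le> d \<and>
    coeff (pcompose p [:1, 1:] - p) d = real (Suc d) * coeff p (Suc d)"
  using assms
proof (induction d arbitrary: p)
  case 0
  obtain a r where p: "p = pCons a r"
    by (cases p)
  then have "degree r = 0"
    using 0 by (cases "r = 0") auto
  then obtain b where "r = [:b:]"
    by (rule degree_eq_zeroE)
  then show ?case
    by (simp add: p pcompose_pCons)
next
  case (Suc d)
  obtain c r where p: "p = pCons c r"
    by (cases p)
  then have r: "degree r \<le> Suc d"
    using Suc.prems by (cases "r = 0") auto
  have eq: "pcompose p [:1, 1:] - p = pCons 0 (pcompose r [:1, 1:] - r) + pcompose r [:1, 1:]"
    by (simp add: p pcompose_pCons mult_pCons_left algebra_simps)
  have "degree (pCons 0 (pcompose r [:1, 1:] - r)) \<le> Suc d"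
    using Suc.IH[OF r] by (simp add: degree_pCons_eq_if)
  then have "degree (pcompose p [:1, 1:] - p) \<le> Suc d"
    unfolding eq using r by (intro degree_add_le) (simp_all add: degree_pcompose)
  moreover have "coeff (pcompose p [:1, 1:] - p) (Suc d) = real (Suc (Suc d)) * coeff p (Suc (Suc d))"
    unfolding eq coeff_add using Suc.IH[OF r] by (simp add: coeff_shift_top[OF r] p algebra_simps)
  ultimately show ?case
    by blast
qed

lemma poly_ext:
  fixes p q :: "real poly"
  shows "(\<And>x. poly p x = poly q x) \<Longrightarrow> p = q"
  by (simp add: poly_eq_poly_eq_iff[symmetric] ext)

text \<open>The columns start at \<open>s\<close> because each branching step removes the smallest
  one; moving \<open>s\<close> avoids renumbering the others.\<close>

definition odd_family :: "nat \<Rightarrow> nat \<Rightarrow> (nat \<Rightarrow> real poly) \<Rightarrow> bool" where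
  "odd_family s n q \<longleftrightarrow> (\<forall>k\<in>{s..<s + n}. degree (q k) = 2 * (k - s) + 1 \<and>
     (\<forall>x. poly (q k) (- x) = - poly (q k) x))"

text \<open>The centred form is the one that preserves oddness.\<close>

definition second_difference :: "real poly \<Rightarrow> real poly" where
  "second_difference q = pcompose q [:1, 1:] - smult 2 q + pcompose q [:- 1, 1:]"

lemma poly_second_difference:
  "poly (second_difference q) x = poly q (x + 1) - 2 * poly q x + poly q (x - 1)"
  by (simp add: second_difference_def poly_pcompose algebra_simps)

lemma degree_forward_difference:
  fixes p :: "real poly"
  assumes "degree p = Suc d"
  shows "degree (pcompose p [:1, 1:] - p) = d"
proof -
  have "p \<noteq> 0"
    using assms by auto
  then have "coeff p (Suc d) \<noteq> 0"
    using leading_coeff_neq_0[of p] assms by simp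
  then have "degree (pcompose p [:1, 1:] - p) \<le> d" "coeff (pcompose p [:1, 1:] - p) d \<noteq> 0"
    using forward_difference_top[of p d] assms by auto
  then show ?thesis
    using le_degree by (intro antisym)
qed

lemma degree_second_difference:
  assumes "degree q = Suc (Suc d)"
  shows "degree (second_difference q) = d"
proof -
  let ?D = "pcompose q [:1, 1:] - q"
  have "second_difference q = pcompose (pcompose ?D [:1, 1:] - ?D) [:- 1, 1:]"
    by (rule poly_ext) (simp add: poly_second_difference poly_pcompose algebra_simps)
  then show ?thesis
    using degree_forward_difference[OF degree_forward_difference[OF assms]]
    by (simp add: degree_pcompose)
qed

lemma odd_family_second_difference:
  "odd_family s (Suc n) q \<Longrightarrow> odd_family (Suc s) n (\<lambda>k. second_difference (q k))"
  unfolding odd_family_def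
proof (intro ballI conjI allI)
  fix k x
  assume q: "\<forall>k\<in>{s..<s + Suc n}. degree (q k) = 2 * (k - s) + 1 \<and>
     (\<forall>x. poly (q k) (- x) = - poly (q k) x)" and k: "k \<in> {Suc s..<Suc s + n}"
  have "2 * (k - s) + 1 = Suc (Suc (2 * (k - Suc s) + 1))"
    using k by auto
  then show "degree (second_difference (q k)) = 2 * (k - Suc s) + 1"
    using q k by (intro degree_second_difference) auto
  have odd: "poly (q k) (- x) = - poly (q k) x" for x
    using q k by auto
  show "poly (second_difference (q k)) (- x) = - poly (second_difference (q k)) x"
    using odd[of x] odd[of "x - 1"] odd[of "x + 1"] by (simp add: poly_second_difference)
qed

text \<open>Two rounds of row operations match the two removed letters; they replace
  \<open>q\<close> by its second differences and use up the linear column. \<open>C\<close> is the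
  product of the slopes of the successive linear columns, so it depends on \<open>q\<close> but not
  on \<open>la\<close>.\<close>

lemma alt_eq_card_nat_tableaux:
  assumes "odd_family s n q"
  shows "\<exists>C :: real. C \<noteq> 0 \<and> (\<forall>la. length la = n \<longrightarrow> sorted_wrt (\<ge>) la \<longrightarrow>
    alt (\<lambda>l k. poly (q k) (real l)) (stair la) {s..<s + n} = C * card (nat_tableaux (2 * n + 2) la))"
  using assms
proof (induction n arbitrary: s q)
  case 0
  have "nat_tableaux (Suc (Suc 0)) [] = {[]}"
    by (auto simp: nat_tableaux_def)
  then show ?case
    by (intro exI[of _ 1]) (simp add: vacuum_def)
next
  case (Suc n)
  obtain C where C: "C \<noteq> (0 :: real)" "\<And>la. length la = n \<Longrightarrow> sorted_wrt (\<ge>) la \<Longrightarrow>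
    alt (\<lambda>l k. poly (second_difference (q k)) (real l)) (stair la) {Suc s..<Suc s + n} =
      C * card (nat_tableaux (2 * n + 2) la)"
    using Suc.IH[OF odd_family_second_difference[OF Suc.prems]]
    by (elim exE conjE) (rule that, assumption, simp)
  have odd: "poly (q k) (- x) = - poly (q k) x" if "k \<in> {s..<s + Suc n}" for k x
    using Suc.prems that by (simp add: odd_family_def)
  have at0: "poly (q k) 0 = 0" if "k \<in> {s..<s + Suc n}" for k
    using odd[OF that, of 0] by simp
  have "degree (q s) = 1"
    using Suc.prems by (simp add: odd_family_def)
  moreover obtain a r where "q s = pCons a r"
    by (cases "q s")
  ultimately have r: "degree r = 0" "r \<noteq> 0" and q_s: "q s = pCons a r"
    by (auto simp: degree_pCons_eq_if split: if_splits)
  then obtain c where c_def: "r = [:c:]"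
    by (blast elim: degree_eq_zeroE)
  then have "q s = [:a, c:]" "c \<noteq> 0"
    using r q_s by auto
  then have c: "poly (q s) x - poly (q s) (x - 1) = c" for x
    by (simp add: algebra_simps)
  let ?J = "{Suc s..<Suc s + n}"
  \<comment> \<open>The three families are set to 0 outside the columns in use: the row operations
    require \<open>p 0\<close> to vanish identically, while oddness is known in these columns
    only.\<close>
  define p where "p l k = (if k \<in> {s..<s + Suc n} then poly (q k) (real l) else 0)" for l k
  define e where "e l k = (if k \<in> {s..<s + Suc n} then poly (q k) (real l) - poly (q k) (real l - 1) else 0)"
    for l k
  define f where "f l k = (if k \<in> {s..<s + Suc n} then poly (second_difference (q k)) (real l) else 0)"
    for l k
  have alt_cong: "alt P ls J = alt R ls J"
    if "\<And>l k. k \<in> I \<Longrightarrow> P l k = R l k" "J \<subseteq> I" for P R ls J I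
    using that(2)
  proof (induction ls arbitrary: J)
    case (Cons l ls)
    then have "alt P ls (J - {k}) = alt R ls (J - {k})" for k
      by blast
    then show ?case
      using that(1) Cons.prems by (auto simp: wedge_def intro!: sum.cong)
  qed simp
  have "alt (\<lambda>l k. poly (q k) (real l)) (stair la) {s..<s + Suc n} =
      (c * C) * card (nat_tableaux (2 * Suc n + 2) la)"
    if la: "length la = Suc n" "sorted_wrt (\<ge>) la" for la
  proof -
    have "alt (\<lambda>l k. poly (q k) (real l)) (stair la) {s..<s + Suc n} = alt p (stair la) {s..<s + Suc n}"
      by (rule alt_cong[of "{s..<s + Suc n}"]) (auto simp: p_def)
    also have "\<dots> = (\<Sum>mu \<in> interlacing la. alt e (stair mu) {s..<s + Suc n})"
      using la by (intro alt_stair_interlacing) (auto simp: p_def e_def at0)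
    also have "\<dots> = (\<Sum>mu \<in> interlacing la. c * (\<Sum>nu \<in> inner_interlacing mu. alt f (stair nu) ?J))"
    proof (intro sum.cong refl)
      fix mu assume mu: "mu \<in> interlacing la"
      have J: "{s..<s + Suc n} = insert s ?J"
        by auto
      have ne: "mu \<noteq> []"
        using sorted_interlacing(2)[OF mu] la by auto
      have e_s: "e (Suc l) s = c" for l
        using c[of "1 + real l"] by (simp add: e_def)
      have f: "f (Suc l) k = e (Suc (Suc l)) k - e (Suc l) k" for l k
        by (simp add: e_def f_def poly_second_difference add_ac)
      show "alt e (stair mu) {s..<s + Suc n} =
          c * (\<Sum>nu \<in> inner_interlacing mu. alt f (stair nu) ?J)"
        unfolding J using sorted_interlacing(1)[OF mu]
        by (intro alt_stair_inner_interlacing[of e s c f, OF e_s f ne]) auto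
    qed
    also have "\<dots> = (\<Sum>mu \<in> interlacing la. c * (\<Sum>nu \<in> inner_interlacing mu.
        C * card (nat_tableaux (2 * n + 2) nu)))"
    proof -
      have "alt f (stair nu) ?J = C * card (nat_tableaux (2 * n + 2) nu)"
        if mu: "mu \<in> interlacing la" and nu: "nu \<in> inner_interlacing mu" for mu nu
      proof -
        have "mu \<noteq> []"
          using sorted_interlacing(2)[OF mu] la by auto
        then have "length nu = n" "sorted_wrt (\<ge>) nu"
          using length_inner_interlacing[OF _ nu] sorted_inner_interlacing[OF _ nu]
            sorted_interlacing(2)[OF mu] la by auto
        moreover have "alt f (stair nu) ?J =
            alt (\<lambda>l k. poly (second_difference (q k)) (real l)) (stair nu) ?J"
          by (rule alt_cong[of "{s..<s + Suc n}"]) (auto simp: f_def)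
        ultimately show ?thesis
          using C(2) by simp
      qed
      then show ?thesis
        by simp
    qed
    also have "\<dots> = (c * C) * card (nat_tableaux (2 * Suc n + 2) la)"
      unfolding card_nat_tableaux_rec[OF la(2,1)] by (simp add: sum_distrib_left mult_ac)
    finally show ?thesis .
  qed
  then show ?case
    using C(1) \<open>c \<noteq> 0\<close> by (intro exI[of _ "c * C"]) auto
qed

section \<open>Tableaux in a box\<close>

definition partitions_in_box :: "nat \<Rightarrow> nat \<Rightarrow> nat list set" where
  "partitions_in_box n r = {la. length la = n \<and> sorted_wrt (\<ge>) la \<and> set la \<subseteq> {0..r}}"

lemma finite_partitions_in_box: "finite (partitions_in_box n r)"
  by (rule finite_subset[OF _ finite_lists_length_eq[of "{0..r}" n]])
    (auto simp: partitions_in_box_def)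

definition rank_letter :: "nat \<Rightarrow> letter" where
  "rank_letter x = (if even x then Plain (x div 2) else Barred (x div 2))"

lemma rank_letter_inverse [simp]: "letter_rank (rank_letter x) = x"
  by (simp add: rank_letter_def)

lemma letter_rank_inverse [simp]: "rank_letter (letter_rank a) = a"
  by (cases a) (simp_all add: rank_letter_def)

lemma alphabet_iff: "a \<in> alphabet n \<longleftrightarrow> 2 \<le> letter_rank a \<and> letter_rank a < 2 * n + 2"
  by (cases a) (auto simp: alphabet_def)

lemma Plain_le_iff: "Plain (Suc i) \<le> a \<longleftrightarrow> 2 * i + 2 \<le> letter_rank a"
  by (simp add: less_eq_letter_def)

lemma partition_rows_split:
  assumes "sorted_wrt (\<ge>) (map length S)"
  shows "S = filter (\<lambda>R. R \<noteq> []) S @ replicate (length S - length (filter (\<lambda>R. R \<noteq> []) S)) []"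
  using assms
proof (induction S)
  case (Cons R S)
  show ?case
  proof (cases "R = []")
    case True
    then have "\<forall>R' \<in> set (R # S). R' = []"
      using Cons.prems by auto
    moreover from this have "filter (\<lambda>R. R \<noteq> []) (R # S) = []"
      by (auto simp: filter_empty_conv)
    ultimately show ?thesis
      by (simp add: replicate_length_same[symmetric])
  qed (use Cons in auto)
qed simp

text \<open>Padding with empty rows to exactly \<open>n\<close> rows is undone by deleting the empty
  rows, which lie at the bottom because row lengths decrease weakly.\<close>

lemma bij_betw_symplectic_tableaux:
  "bij_betw (\<lambda>T. map (map letter_rank) T @ replicate (n - length T) [])
     (symplectic_tableaux n r) (\<Union>la \<in> partitions_in_box n r. nat_tableaux (2 * n + 2) la)"
  (is "bij_betw ?f ?A ?B")
proof (rule bij_betw_byWitness[where f' = "\<lambda>S. map (map rank_letter) (filter (\<lambda>R. R \<noteq> []) S)"])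
  show "\<forall>T \<in> ?A. map (map rank_letter) (filter (\<lambda>R. R \<noteq> []) (?f T)) = T"
  proof
    fix T assume "T \<in> ?A"
    then have "\<forall>R \<in> set T. R \<noteq> []"
      by (force simp: symplectic_tableaux_def symplectic_tableau_def semistandard_def
          is_partition_def shape_def)
    then have "filter (\<lambda>R. R \<noteq> []) (map (map letter_rank) T) = map (map letter_rank) T"
      by (auto simp: filter_id_conv)
    then show "map (map rank_letter) (filter (\<lambda>R. R \<noteq> []) (?f T)) = T"
      by (simp add: o_def map_idI)
  qed
  show "?f ` ?A \<subseteq> ?B"
  proof clarify
    fix T assume "T \<in> ?A"
    then have T: "sorted_wrt (\<ge>) (map length T)" "\<forall>R \<in> set T. sorted R"
        "\<forall>i j. Suc i < length T \<longrightarrow> j < length (T ! Suc i) \<longrightarrow> T ! i ! j < T ! Suc i ! j"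
        "\<forall>R \<in> set T. set R \<subseteq> alphabet n"
        "\<forall>i < length T. \<forall>x \<in> set (T ! i). Plain (Suc i) \<le> x"
        "length T \<le> n" "width T \<le> r"
      by (auto simp: symplectic_tableaux_def symplectic_tableau_def semistandard_def
          is_partition_def shape_def height_def)
    let ?la = "map length (?f T)"
    have "\<forall>R \<in> set T. length R \<le> r"
      using T(1,7) by (cases T) (auto simp: width_def)
    moreover have "sorted_wrt (\<ge>) (replicate m (0 :: nat))" for m
      by (induction m) auto
    ultimately have "?la \<in> partitions_in_box n r"
      using T(1,6) by (auto simp: partitions_in_box_def sorted_wrt_append o_def)
    moreover have "?f T \<in> nat_tableaux (2 * n + 2) ?la"
    proof -
      have nth: "?f T ! i = (if i < length T then map letter_rank (T ! i) else [])" if "i < n" for i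
        using that T(6) by (auto simp: nth_append)
      have len: "length (?f T) = n"
        using T(6) by simp
      have "sorted R" if "R \<in> set (?f T)" for R
        using that T(2) by (auto simp: sorted_map less_eq_letter_def[abs_def])
      moreover have "2 * i + 2 \<le> x \<and> x < 2 * n + 2" if "i < n" "x \<in> set (?f T ! i)" for i x
      proof -
        obtain a where a: "i < length T" "a \<in> set (T ! i)" "x = letter_rank a"
          using \<open>x \<in> set (?f T ! i)\<close> unfolding nth[OF \<open>i < n\<close>] by (auto split: if_splits)
        then have "a \<in> alphabet n" "Plain (Suc i) \<le> a"
          using T(4,5) nth_mem[of i T] by auto
        then show ?thesis
          by (simp add: a(3) Plain_le_iff alphabet_iff)
      qed
      moreover have "?f T ! i ! j < ?f T ! Suc i ! j"
        if i: "Suc i < n" and j: "j < length (?f T ! Suc i)" for i j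
      proof -
        have "Suc i < length T" "j < length (T ! Suc i)"
          using i j by (auto simp: nth split: if_splits)
        moreover from this have "j < length (T ! i)"
          using sorted_wrt_nth_less[OF T(1), of i "Suc i"] by simp
        ultimately show ?thesis
          using i T(3) by (simp add: nth less_letter_def)
      qed
      ultimately show ?thesis
        unfolding nat_tableaux_def mem_Collect_eq len by blast
    qed
    ultimately show "?f T \<in> ?B"
      by blast
  qed
  have split: "S = filter (\<lambda>R. R \<noteq> []) S @ replicate (n - length (filter (\<lambda>R. R \<noteq> []) S)) []"
    and S: "length S = n" "sorted_wrt (\<ge>) (map length S)" "\<forall>R \<in> set S. length R \<le> r"
    "\<forall>R \<in> set S. sorted R"
    "\<forall>i < n. \<forall>x \<in> set (S ! i). 2 * i + 2 \<le> x \<and> x < 2 * n + 2"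
    "\<forall>i j. Suc i < n \<longrightarrow> j < length (S ! Suc i) \<longrightarrow> S ! i ! j < S ! Suc i ! j"
    if "S \<in> ?B" for S
  proof -
    from that show S: "length S = n" "sorted_wrt (\<ge>) (map length S)" "\<forall>R \<in> set S. length R \<le> r"
      "\<forall>R \<in> set S. sorted R"
      "\<forall>i < n. \<forall>x \<in> set (S ! i). 2 * i + 2 \<le> x \<and> x < 2 * n + 2"
      "\<forall>i j. Suc i < n \<longrightarrow> j < length (S ! Suc i) \<longrightarrow> S ! i ! j < S ! Suc i ! j"
      by (auto simp: partitions_in_box_def nat_tableaux_def)
    show "S = filter (\<lambda>R. R \<noteq> []) S @ replicate (n - length (filter (\<lambda>R. R \<noteq> []) S)) []"
      using partition_rows_split[OF S(2)] S(1) by simp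
  qed
  show "\<forall>S \<in> ?B. ?f (map (map rank_letter) (filter (\<lambda>R. R \<noteq> []) S)) = S"
  proof
    fix S assume "S \<in> ?B"
    from split[OF this] show "?f (map (map rank_letter) (filter (\<lambda>R. R \<noteq> []) S)) = S"
      by (simp add: o_def)
  qed
  show "(\<lambda>S. map (map rank_letter) (filter (\<lambda>R. R \<noteq> []) S)) ` ?B \<subseteq> ?A"
  proof (rule image_subsetI)
    fix S assume "S \<in> ?B"
    note split = split[OF this] and S = S[OF this]
    let ?S = "filter (\<lambda>R. R \<noteq> []) S"
    have len: "length ?S \<le> n"
      using S(1) length_filter_le[of _ S] by simp
    have nth: "S ! i = ?S ! i" if "i < length ?S" for i
      using that by (subst split) (simp add: nth_append)
    have "sorted_wrt (\<ge>) (map length ?S)"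
      using S(2) by (simp add: sorted_wrt_map sorted_wrt_filter)
    moreover have "sorted (map rank_letter R)" if "R \<in> set ?S" for R
      using that S(4) by (simp add: sorted_wrt_map less_eq_letter_def)
    moreover have letters: "rank_letter x \<in> alphabet n \<and> Plain (Suc i) \<le> rank_letter x"
      if "i < length ?S" "x \<in> set (?S ! i)" for i x
    proof -
      have "i < n" "x \<in> set (S ! i)"
        using that len nth[OF that(1)] by simp_all
      then have "2 * i + 2 \<le> x" "x < 2 * n + 2"
        using S(5) by blast+
      then show ?thesis
        by (simp add: alphabet_iff Plain_le_iff)
    qed
    moreover have "rank_letter (?S ! i ! j) < rank_letter (?S ! Suc i ! j)"
      if "Suc i < length ?S" "j < length (?S ! Suc i)" for i j
    proof -
      have "Suc i < n" "j < length (S ! Suc i)"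
        using that len nth[of "Suc i"] by simp_all
      then have "S ! i ! j < S ! Suc i ! j"
        using S(6) by blast
      then show ?thesis
        using that nth[of i] nth[of "Suc i"] by (simp add: less_letter_def)
    qed
    moreover have "length (?S ! Suc i) \<le> length (?S ! i)" if "Suc i < length ?S" for i
      using that sorted_wrt_nth_less[OF \<open>sorted_wrt (\<ge>) (map length ?S)\<close>, of i "Suc i"] by simp
    moreover have "width (map (map rank_letter) ?S) \<le> r"
    proof (cases ?S)
      case (Cons R Rs)
      then have "R \<in> set ?S"
        by simp
      then have "R \<in> set S"
        by simp
      then show ?thesis
        using S(3) Cons by (simp add: width_def)
    qed (simp add: width_def)
    moreover have "set (map rank_letter R) \<subseteq> alphabet n" if R: "R \<in> set ?S" for R
    proof -
      obtain i where "i < length ?S" "R = ?S ! i"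
        using R by (metis in_set_conv_nth)
      then show ?thesis
        using letters by auto
    qed
    ultimately show "map (map rank_letter) ?S \<in> ?A"
      using len letters unfolding symplectic_tableaux_def symplectic_tableau_def semistandard_def
        is_partition_def shape_def height_def mem_Collect_eq
      by (auto simp: o_def less_le_trans)
  qed
qed

lemma sum_symplectic_tableaux:
  fixes g :: real
  shows "(\<Sum>T \<in> symplectic_tableaux n r. g ^ num_squares T) =
    (\<Sum>la \<in> partitions_in_box n r. g ^ sum_list la * card (nat_tableaux (2 * n + 2) la))"
proof -
  let ?f = "\<lambda>T. map (map letter_rank) T @ replicate (n - length T) []"
  let ?w = "\<lambda>S :: nat list list. g ^ sum_list (map length S)"
  have "num_squares T = sum_list (map length (?f T))" for T
    by (simp add: num_squares_def shape_def o_def)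
  then have "(\<Sum>T \<in> symplectic_tableaux n r. g ^ num_squares T) =
      (\<Sum>T \<in> symplectic_tableaux n r. ?w (?f T))"
    by simp
  also have "\<dots> = sum ?w (\<Union>la \<in> partitions_in_box n r. nat_tableaux (2 * n + 2) la)"
    by (rule sum.reindex_bij_betw[OF bij_betw_symplectic_tableaux])
  also have "\<dots> = (\<Sum>la \<in> partitions_in_box n r. \<Sum>S \<in> nat_tableaux (2 * n + 2) la. ?w S)"
    by (rule sum.UNION_disjoint)
      (simp_all add: finite_partitions_in_box finite_nat_tableaux, auto simp: nat_tableaux_def)
  also have "\<dots> = (\<Sum>la \<in> partitions_in_box n r. \<Sum>S \<in> nat_tableaux (2 * n + 2) la. g ^ sum_list la)"
    by (intro sum.cong refl) (auto simp: nat_tableaux_def)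
  finally show ?thesis
    by (simp add: mult.commute)
qed

section \<open>Strictly decreasing lists and the staircase shift\<close>

definition decreasing_lists :: "nat \<Rightarrow> nat list set" where
  "decreasing_lists N = {ls. sorted_wrt (>) ls \<and> set ls \<subseteq> {1..N}}"

lemma decreasing_lists_0: "decreasing_lists 0 = {[]}"
  by (auto simp: decreasing_lists_def)

lemma decreasing_lists_Suc:
  "decreasing_lists (Suc N) = decreasing_lists N \<union> (#) (Suc N) ` decreasing_lists N"
proof -
  have "ls \<in> decreasing_lists N \<union> (#) (Suc N) ` decreasing_lists N"
    if ls: "ls \<in> decreasing_lists (Suc N)" for ls
  proof (cases ls)
    case (Cons l ls')
    show ?thesis
    proof (cases "l = Suc N")
      case True
      then have "ls' \<in> decreasing_lists N"
        using ls by (force simp: Cons decreasing_lists_def)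
      then show ?thesis
        by (simp add: Cons True)
    next
      case False
      then have "ls \<in> decreasing_lists N"
        using ls by (force simp: Cons decreasing_lists_def)
      then show ?thesis ..
    qed
  qed (auto simp: decreasing_lists_def)
  moreover have "ls \<in> decreasing_lists (Suc N)"
    if "ls \<in> decreasing_lists N \<union> (#) (Suc N) ` decreasing_lists N" for ls
    using that by (force simp: decreasing_lists_def)
  ultimately show ?thesis
    by blast
qed

lemma finite_decreasing_lists: "finite (decreasing_lists N)"
  by (induction N) (simp_all add: decreasing_lists_0 decreasing_lists_Suc)

text \<open>Expanding the product \<open>(1 + p N) \<and> ... \<and> (1 + p 1)\<close> selects a set
  of factors, met in decreasing order of their indices.\<close>

lemma chain_sum_eq_sum_alt: "chain_sum p N J = (\<Sum>ls \<in> decreasing_lists N. alt p ls J)"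
proof (induction N arbitrary: J)
  case (Suc N)
  have "decreasing_lists N \<inter> (#) (Suc N) ` decreasing_lists N = {}"
    by (auto simp: decreasing_lists_def)
  then have "(\<Sum>ls \<in> decreasing_lists (Suc N). alt p ls J) =
      (\<Sum>ls \<in> decreasing_lists N. alt p ls J) +
      (\<Sum>ls \<in> decreasing_lists N. wedge (p (Suc N)) (alt p ls) J)"
    unfolding decreasing_lists_Suc
    by (simp add: sum.union_disjoint finite_decreasing_lists sum.reindex inj_on_def)
  also have "\<dots> = chain_sum p (Suc N) J"
  proof -
    have "chain_sum p N = (\<lambda>J. \<Sum>ls \<in> decreasing_lists N. alt p ls J)"
      using Suc by (intro ext)
    then show ?thesis
      by (simp add: wedge_sum_right)
  qed
  finally show ?case ..
qed (simp add: decreasing_lists_0)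

lemma alt_eq_0: "finite J \<Longrightarrow> length ls \<noteq> card J \<Longrightarrow> alt p ls J = 0"
proof (induction ls arbitrary: J)
  case (Cons l ls)
  have "alt p ls (J - {k}) = 0" if "k \<in> J" for k
    using Cons.prems card.remove[OF Cons.prems(1) that] by (intro Cons.IH) auto
  then show ?case
    by (simp add: wedge_def)
qed (auto simp: vacuum_def)

lemma alt_scale: "alt (\<lambda>l k. g ^ l * p l k) ls J = g ^ sum_list ls * alt p ls J"
proof (induction ls arbitrary: J)
  case (Cons l ls)
  then have "alt (\<lambda>l k. g ^ l * p l k) ls = (\<lambda>J. g ^ sum_list ls * alt p ls J)"
    by (intro ext)
  then show ?case
    by (simp add: wedge_scale_left wedge_scale_right power_add)
qed simp

lemma length_stair [simp]: "length (stair la) = length la"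
  by (induction la) simp_all

lemma sum_list_stair: "sum_list (stair la) = sum_list la + \<Sum>{1..length la}"
  by (induction la) simp_all

lemma stair_inject: "stair la = stair mu \<Longrightarrow> la = mu"
proof (induction la arbitrary: mu)
  case Nil
  then show ?case
    by (cases mu) auto
next
  case (Cons a la)
  then show ?case
    by (cases mu) (auto dest: arg_cong[of _ _ length])
qed

lemma stair_le: "sorted_wrt (\<ge>) la \<Longrightarrow> l \<in> set (stair la) \<Longrightarrow> 1 \<le> l \<and> l \<le> head0 la + length la"
proof (induction la)
  case (Cons a la)
  then show ?case
    using head0_le[OF Cons.prems(1)] by fastforce
qed simp

lemma stair_decreasing: "sorted_wrt (\<ge>) la \<Longrightarrow> sorted_wrt (>) (stair la)"
proof (induction la)
  case (Cons a la)
  have "l < Suc (a + length la)" if "l \<in> set (stair la)" for l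
    using stair_le[OF _ that] head0_le[OF Cons.prems] Cons.prems by force
  then show ?case
    using Cons by simp
qed simp

lemma stair_surj:
  "sorted_wrt (>) ls \<Longrightarrow> \<forall>l \<in> set ls. 1 \<le> l \<Longrightarrow> \<exists>la. sorted_wrt (\<ge>) la \<and> stair la = ls"
proof (induction ls)
  case (Cons l ls)
  then obtain la where la: "sorted_wrt (\<ge>) la" "stair la = ls"
    by auto
  have "head0 la + length la < l"
    using Cons.prems la(2) by (cases la) auto
  moreover have "b \<le> head0 la" if "b \<in> set la" for b
    using la(1) that by (cases la) auto
  ultimately have "sorted_wrt (\<ge>) ((l - Suc (length la)) # la)"
      "stair ((l - Suc (length la)) # la) = l # ls"
    using la by fastforce+
  then show ?case
    by blast
qed (auto intro: exI[of _ "[]"])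

lemma bij_betw_stair:
  "bij_betw stair (partitions_in_box n r) {ls \<in> decreasing_lists (n + r). length ls = n}"
proof (rule bij_betwI')
  fix la assume la: "la \<in> partitions_in_box n r"
  then have "head0 la \<le> r"
    by (cases la) (auto simp: partitions_in_box_def)
  then have "set (stair la) \<subseteq> {1..n + r}"
    using la stair_le[of la] by (force simp: partitions_in_box_def)
  then show "stair la \<in> {ls \<in> decreasing_lists (n + r). length ls = n}"
    using la stair_decreasing by (simp add: partitions_in_box_def decreasing_lists_def)
next
  fix ls assume ls: "ls \<in> {ls \<in> decreasing_lists (n + r). length ls = n}"
  then have "\<exists>la. sorted_wrt (\<ge>) la \<and> stair la = ls"
    by (intro stair_surj) (auto simp: decreasing_lists_def)
  then obtain la where la: "sorted_wrt (\<ge>) la" "stair la = ls"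
    by blast
  have "set la \<subseteq> {0..r}"
    using la ls by (cases la) (auto simp: decreasing_lists_def intro: order_trans)
  then have "la \<in> partitions_in_box n r"
    using la ls by (auto simp: partitions_in_box_def)
  then show "\<exists>la \<in> partitions_in_box n r. ls = stair la"
    using la by blast
qed (auto dest: stair_inject)

text \<open>The values 1 and -1 of \<open>g\<close> give the two sums of the theorem. Weighting row
  \<open>l\<close> by \<open>g ^ l\<close> produces the weight of the shape and a fixed power of
  \<open>g\<close> for the staircase. Since \<open>C\<close> does not depend on \<open>r\<close>,
  different families \<open>q\<close> lead to proportional functions of \<open>r\<close>.\<close>

lemma chain_sum_eq_tableaux:
  assumes "odd_family 0 n q"
  shows "\<exists>C :: real. C \<noteq> 0 \<and> (\<forall>g r. chain_sum (\<lambda>l k. g ^ l * poly (q k) (real l)) (n + r) {0..<n} =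
    C * g ^ \<Sum>{1..n} * (\<Sum>T \<in> symplectic_tableaux n r. g ^ num_squares T))"
proof -
  obtain C where C: "C \<noteq> (0 :: real)" "\<And>la. length la = n \<Longrightarrow> sorted_wrt (\<ge>) la \<Longrightarrow>
      alt (\<lambda>l k. poly (q k) (real l)) (stair la) {0..<n} = C * card (nat_tableaux (2 * n + 2) la)"
    using alt_eq_card_nat_tableaux[OF assms] by auto
  have "chain_sum (\<lambda>l k. g ^ l * poly (q k) (real l)) (n + r) {0..<n} =
      C * g ^ \<Sum>{1..n} * (\<Sum>T \<in> symplectic_tableaux n r. g ^ num_squares T)" for g r
  proof -
    let ?p = "\<lambda>l k. g ^ l * poly (q k) (real l)"
    have "chain_sum ?p (n + r) {0..<n} =
        (\<Sum>ls \<in> {ls \<in> decreasing_lists (n + r). length ls = n}. alt ?p ls {0..<n})"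
      unfolding chain_sum_eq_sum_alt
      by (rule sum.mono_neutral_right) (auto simp: finite_decreasing_lists intro!: alt_eq_0)
    also have "\<dots> = (\<Sum>la \<in> partitions_in_box n r. alt ?p (stair la) {0..<n})"
      by (rule sum.reindex_bij_betw[OF bij_betw_stair, symmetric])
    also have "\<dots> = (\<Sum>la \<in> partitions_in_box n r.
        C * g ^ \<Sum>{1..n} * (g ^ sum_list la * card (nat_tableaux (2 * n + 2) la)))"
      by (intro sum.cong refl)
        (simp add: alt_scale C(2) sum_list_stair power_add partitions_in_box_def)
    finally show ?thesis
      by (simp add: sum_symplectic_tableaux sum_distrib_left)
  qed
  then show ?thesis
    using C(1) by blast
qed

section \<open>The unsigned sum\<close>

lemma poly_eqI_inj:
  fixes p q :: "real poly"
  assumes "inj (y :: nat \<Rightarrow> real)" "\<And>n. poly p (y n) = poly q (y n)"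
  shows "p = q"
proof (rule ccontr)
  assume "p \<noteq> q"
  then have "finite {x. poly (p - q) x = 0}"
    by (intro poly_roots_finite) simp
  moreover have "range y \<subseteq> {x. poly (p - q) x = 0}"
    using assms(2) by auto
  ultimately have "finite (range y)"
    by (rule finite_subset[rotated])
  then show False
    using assms(1) by (simp add: finite_image_iff)
qed

section \<open>Summation of polynomials and its reflection symmetry\<close>

abbreviation shift :: "real poly \<Rightarrow> real poly" where
  "shift p \<equiv> pcompose p [:- 1, 1:]"

abbreviation reflect :: "real poly \<Rightarrow> real poly" where
  "reflect p \<equiv> pcompose p [:- 1, - 1:]"

lemma poly_shift [simp]: "poly (shift p) x = poly p (x - 1)"
  by (simp add: poly_pcompose algebra_simps)

lemma poly_reflect [simp]: "poly (reflect p) x = poly p (- 1 - x)"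
  by (simp add: poly_pcompose algebra_simps)

lemma poly_pderiv_shift [simp]: "poly (pderiv (shift p)) x = poly (pderiv p) (x - 1)"
  by (simp add: pderiv_pcompose pderiv_pCons)

lemma poly_pderiv_reflect [simp]: "poly (pderiv (reflect p)) x = - poly (pderiv p) (- 1 - x)"
  by (simp add: pderiv_pcompose pderiv_pCons)

lemma degree_shift [simp]: "degree (shift p) = degree p"
  by (simp add: degree_pcompose)

lemma degree_reflect [simp]: "degree (reflect p) = degree p"
  by (simp add: degree_pcompose)

lemma forward_difference_surj:
  fixes f :: "real poly"
  assumes "\<And>i. i \<ge> d \<Longrightarrow> coeff f i = 0"
  shows "\<exists>h. pcompose h [:1, 1:] - h = f \<and> degree h \<le> d"
  using assms
proof (induction d arbitrary: f)
  case 0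
  then have "f = 0"
    by (intro poly_eqI) simp
  then show ?case
    by (intro exI[of _ 0]) simp
next
  case (Suc d)
  define h0 where "h0 = monom (coeff f d / real (Suc d)) (Suc d)"
  have h0: "degree h0 \<le> Suc d"
    by (simp add: h0_def degree_monom_le)
  note top = forward_difference_top[OF h0]
  have "coeff (f - (pcompose h0 [:1, 1:] - h0)) i = 0" if "i \<ge> d" for i
  proof (cases "i = d")
    case True
    have "coeff h0 (Suc d) = coeff f d / real (Suc d)"
      by (simp add: h0_def)
    then show ?thesis
      using top True by simp
  next
    case False
    then have "coeff (pcompose h0 [:1, 1:] - h0) i = 0"
      using that top by (intro coeff_eq_0) simp
    then show ?thesis
      using False that Suc.prems[of i] by simp
  qed
  then obtain h1 where h1: "pcompose h1 [:1, 1:] - h1 = f - (pcompose h0 [:1, 1:] - h0)" "degree h1 \<le> d"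
    using Suc.IH by blast
  show ?case
  proof (intro exI conjI)
    show "pcompose (h0 + h1) [:1, 1:] - (h0 + h1) = f"
      using h1(1) by (simp add: pcompose_add algebra_simps)
    show "degree (h0 + h1) \<le> Suc d"
      using h0 h1(2) by (intro degree_add_le) auto
  qed
qed

lemma antidifference_exists:
  fixes f :: "real poly"
  shows "\<exists>g. (\<forall>x. poly g x - poly g (x - 1) = poly f x) \<and> poly g 0 = 0 \<and> degree g \<le> Suc (degree f)"
proof -
  obtain h where h: "pcompose h [:1, 1:] - h = f" "degree h \<le> Suc (degree f)"
    using forward_difference_surj[of "Suc (degree f)" f] by (auto simp: coeff_eq_0)
  let ?g = "pcompose h [:1, 1:] - [:poly h 1:]"
  have "poly ?g x - poly ?g (x - 1) = poly f x" for x
    by (simp add: h(1)[symmetric] poly_pcompose add.commute)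
  moreover have "degree ?g \<le> Suc (degree f)"
    using h(2) by (intro degree_diff_le) (simp_all add: degree_pcompose)
  moreover have "poly ?g 0 = 0"
    by (simp add: poly_pcompose)
  ultimately show ?thesis
    by blast
qed

text \<open>At \<open>real N\<close> this is \<open>f 1 + ... + f N\<close>. As a polynomial it also
  has values at negative integers, where the reflected zeros lie.\<close>

definition antidiff :: "real poly \<Rightarrow> real poly" where
  "antidiff f = (SOME g. (\<forall>x. poly g x - poly g (x - 1) = poly f x) \<and> poly g 0 = 0
     \<and> degree g \<le> Suc (degree f))"

lemma antidiff: "poly (antidiff f) x = poly (antidiff f) (x - 1) + poly f x"
  and antidiff_0 [simp]: "poly (antidiff f) 0 = 0"
  and degree_antidiff: "degree (antidiff f) \<le> Suc (degree f)"
proof -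
  note * = someI_ex[OF antidifference_exists[of f], folded antidiff_def]
  show "poly (antidiff f) x = poly (antidiff f) (x - 1) + poly f x"
    using * by (metis diff_add_cancel add.commute)
  show "poly (antidiff f) 0 = 0" "degree (antidiff f) \<le> Suc (degree f)"
    using * by blast+
qed

lemma antidiff_unique:
  assumes "\<And>x. poly g x = poly g (x - 1) + poly f x" "poly g 0 = 0"
  shows "g = antidiff f"
proof (rule poly_eqI_inj[of real])
  show "poly g (real n) = poly (antidiff f) (real n)" for n
  proof (induction n)
    case (Suc n)
    then show ?case
      using assms(1)[of "real (Suc n)"] antidiff[of f "real (Suc n)"] by simp
  qed (simp add: assms(2))
qed (simp add: inj_def)

lemma poly_pderiv_antidiff:
  "poly (pderiv (antidiff f)) x = poly (pderiv (antidiff f)) (x - 1) + poly (pderiv f) x"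
proof -
  have "antidiff f = shift (antidiff f) + f"
    by (rule poly_ext) (simp add: antidiff[symmetric])
  then have "pderiv (antidiff f) = pderiv (shift (antidiff f)) + pderiv f"
    by (metis pderiv_add)
  then show ?thesis
    by (metis poly_add poly_pderiv_shift)
qed

text \<open>For odd \<open>f\<close> the reflected polynomial satisfies the same recursion, and it
  vanishes at 0 because \<open>f\<close> does.\<close>

lemma antidiff_reflect:
  assumes "\<And>x. poly f (- x) = - poly f x"
  shows "poly (antidiff f) (- 1 - x) = poly (antidiff f) x"
proof -
  have "reflect (antidiff f) = antidiff f"
  proof (rule antidiff_unique)
    fix x
    have "poly (antidiff f) (- x) = poly (antidiff f) (- x - 1) - poly f x"
      using antidiff[of f "- x"] assms[of x] by simp
    moreover have "- 1 - (x - 1) = - x" "- x - 1 = - 1 - x"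
      by auto
    ultimately show "poly (reflect (antidiff f)) x = poly (reflect (antidiff f)) (x - 1) + poly f x"
      by simp
    show "poly (reflect (antidiff f)) 0 = 0"
      using antidiff[of f 0] assms[of 0] by simp
  qed
  then show ?thesis
    by (metis poly_reflect)
qed

lemma double_root_dvd:
  fixes p :: "real poly"
  assumes "poly p c = 0" "poly (pderiv p) c = 0"
  shows "[:- c, 1:] ^ 2 dvd p"
proof -
  obtain q where q: "p = [:- c, 1:] * q"
    using assms(1) by (auto simp: poly_eq_0_iff_dvd)
  have "poly q c = 0"
    using assms(2) by (simp add: q pderiv_mult pderiv_pCons del: mult_pCons_left)
  then have "[:- c, 1:] * [:- c, 1:] dvd [:- c, 1:] * q"
    unfolding poly_eq_0_iff_dvd by (rule mult_dvd_mono[OF dvd_refl])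
  then show ?thesis
    unfolding q power2_eq_square .
qed

lemma prod_linear_powers_dvd:
  fixes p :: "real poly"
  assumes "finite I" "inj_on a I" "\<And>i. i \<in> I \<Longrightarrow> [:- a i, 1:] ^ e i dvd p"
  shows "(\<Prod>i\<in>I. [:- a i, 1:] ^ e i) dvd p"
  using assms
proof (induction I)
  case (insert i I)
  let ?P = "\<Prod>i\<in>I. [:- a i, 1:] ^ e i"
  obtain q where q: "p = ?P * q"
    using insert by auto
  show ?case
  proof (cases "p = 0")
    case False
    have "poly ?P (a i) \<noteq> 0"
      using insert by (auto simp: poly_prod)
    then have "order (a i) ?P = 0"
      by (rule order_0I)
    then have "order (a i) p = order (a i) q"
      using False q order_mult[of ?P q "a i"] by simp
    then have "[:- a i, 1:] ^ e i dvd q"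
      using insert.prems(2)[of i] False q by (auto simp: order_divides)
    then show ?thesis
      using insert by (simp add: q mult.commute)
  qed simp
qed simp

text \<open>The members with \<open>k \<ge> m\<close> have the \<open>2m + 1\<close> zeros
  \<open>-m, ..., m\<close>, the zero at 0 coming from oddness alone. Those with
  \<open>k < m\<close> have too small a degree for this and only complete the family.\<close>

definition vanishing_family :: "nat \<Rightarrow> nat \<Rightarrow> real poly" where
  "vanishing_family m k = (if k < m then monom 1 (2 * k + 1)
     else monom 1 (2 * (k - m) + 1) * (\<Prod>i\<in>{1..m}. [:- (real i ^ 2), 0, 1:]))"

lemma odd_family_vanishing_family: "odd_family 0 n (vanishing_family m)"
proof -
  have "degree (vanishing_family m k) = 2 * k + 1" for k
  proof (cases "k < m")
    case False
    have "degree (\<Prod>i\<in>{1..m}. [:- (real i ^ 2), 0, 1:]) = (\<Sum>i\<in>{1..m}. degree [:- (real i ^ 2), 0, 1:])"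
      by (intro degree_prod_eq_sum_degree) auto
    then have "degree (\<Prod>i\<in>{1..m}. [:- (real i ^ 2), 0, 1:]) = 2 * m"
      by simp
    moreover have "(\<Prod>i\<in>{1..m}. [:- (real i ^ 2), 0, 1:]) \<noteq> 0"
      by auto
    ultimately show ?thesis
      using False by (simp add: vanishing_family_def degree_mult_eq degree_monom_eq)
  qed (simp add: vanishing_family_def degree_monom_eq)
  then show ?thesis
    by (auto simp: odd_family_def vanishing_family_def poly_monom poly_prod)
qed

lemma vanishing_family_eq_0:
  assumes "m \<le> k" "i \<le> m"
  shows "poly (vanishing_family m k) (real i) = 0"
  using assms by (cases "i = 0") (auto simp: vanishing_family_def poly_monom poly_prod power2_eq_square
      intro!: bexI[of _ i])

text \<open>The sum defining \<open>pform\<close> as a polynomial in \<open>N\<close>;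
  \<open>shift\<close> accounts for the index \<open>i - 1\<close> of the inner sum.\<close>

definition pair_form :: "real poly \<Rightarrow> real poly \<Rightarrow> real poly" where
  "pair_form f g = antidiff (f * shift (antidiff g) - g * shift (antidiff f))"

lemma psum_poly: "psum (\<lambda>l k. poly (q k) (real l)) N k = poly (antidiff (q k)) (real N)"
proof (induction N)
  case (Suc N)
  then show ?case
    using antidiff[of "q k" "real (Suc N)"] by (simp add: psum_Suc)
qed simp

lemma pform_poly:
  "pform (\<lambda>l k. poly (q k) (real l)) N k l = poly (pair_form (q k) (q l)) (real N)"
proof (induction N)
  case (Suc N)
  then show ?case
    using antidiff[of "q k * shift (antidiff (q l)) - q l * shift (antidiff (q k))" "real (Suc N)"]
    by (simp add: pform_Suc pair_form_def psum_poly)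
qed (simp add: pair_form_def)

lemma degree_pair_form: "degree (pair_form f g) \<le> degree f + degree g + 2"
proof -
  have "degree (f * shift (antidiff g)) \<le> degree f + Suc (degree g)"
    using degree_mult_le[of f "shift (antidiff g)"] degree_antidiff[of g] by simp
  moreover have "degree (g * shift (antidiff f)) \<le> degree g + Suc (degree f)"
    using degree_mult_le[of g "shift (antidiff f)"] degree_antidiff[of f] by simp
  ultimately have "degree (f * shift (antidiff g) - g * shift (antidiff f)) \<le> Suc (degree f + degree g)"
    by (intro degree_diff_le) auto
  then show ?thesis
    unfolding pair_form_def using degree_antidiff le_trans by fastforce
qed

lemma psum_eq_0: "(\<And>i. i \<le> m \<Longrightarrow> p i k = 0) \<Longrightarrow> psum p m k = 0"
  by (simp add: psum_def)

lemma pform_eq_0: "(\<And>i. i \<le> m \<Longrightarrow> p i k = 0) \<Longrightarrow> pform p m k l = 0"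
  by (auto simp: pform_def psum_def intro!: sum.neutral)

text \<open>The summand is odd: reflection turns \<open>antidiff f\<close> at \<open>x - 1\<close>
  into its value at \<open>x\<close>, which is larger by \<open>f x\<close>, and the extra products
  of \<open>f\<close> and \<open>g\<close> cancel by skew symmetry.\<close>

lemma pair_form_reflect:
  assumes odd: "\<And>x. poly f (- x) = - poly f x" "\<And>x. poly g (- x) = - poly g x"
  shows "reflect (pair_form f g) = pair_form f g"
  unfolding pair_form_def
proof (rule antidiff_unique)
  let ?d = "f * shift (antidiff g) - g * shift (antidiff f)"
  fix x
  have A: "poly (antidiff h) (- x - 1) = poly (antidiff h) x"
    if "\<And>x. poly h (- x) = - poly h x" for h
    using antidiff_reflect[OF that, of x] by (metis minus_diff_commute)
  have "poly ?d (- x) = - poly ?d x"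
    using A[of f] A[of g] odd antidiff[of f x] antidiff[of g x] by (simp add: algebra_simps)
  then have "poly (antidiff ?d) (- x) = poly (antidiff ?d) (- x - 1) - poly ?d x"
    using antidiff[of ?d "- x"] by simp
  moreover have "- 1 - (x - 1) = - x" "- x - 1 = - 1 - x"
    by auto
  ultimately show "poly (reflect (antidiff ?d)) x = poly (reflect (antidiff ?d)) (x - 1) + poly ?d x"
    by (simp only: poly_reflect)
next
  have "poly f 0 = 0" "poly g 0 = 0"
    using odd[of 0] by auto
  then show "poly (reflect (antidiff (f * shift (antidiff g) - g * shift (antidiff f)))) 0 = 0"
    using antidiff[of "f * shift (antidiff g) - g * shift (antidiff f)" 0] by simp
qed

text \<open>At \<open>0, ..., m\<close> both factors of each product in the summand vanish, so the
  derivative of the summand does too, and the derivative of the sum is the same at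
  \<open>-1, 0, ..., m\<close>. By reflection its values at \<open>-1\<close> and \<open>0\<close>
  are opposite, so it is 0.\<close>

lemma pderiv_pair_form_eq_0:
  assumes odd: "\<And>x. poly f (- x) = - poly f x" "\<And>x. poly g (- x) = - poly g x"
    and zero: "\<And>i. i \<le> m \<Longrightarrow> poly f (real i) = 0" "\<And>i. i \<le> m \<Longrightarrow> poly g (real i) = 0"
  shows "poly (pderiv (pair_form f g)) (real m) = 0"
proof -
  let ?d = "f * shift (antidiff g) - g * shift (antidiff f)"
  have A: "poly (antidiff h) (real i - 1) = 0"
    if "\<And>x. poly h (- x) = - poly h x" "\<And>i. i \<le> m \<Longrightarrow> poly h (real i) = 0" "i \<le> m" for h i
    using that(3)
  proof (induction i)
    case 0
    then show ?case
      using antidiff[of h 0] that(2)[of 0] by simp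
  next
    case (Suc i)
    then show ?case
      using antidiff[of h "real i"] that(2)[of i] by simp
  qed
  have d: "poly (pderiv ?d) (real i) = 0" if "i \<le> m" for i
    using A[OF odd(1) zero(1) that] A[OF odd(2) zero(2) that] zero that
    by (simp add: pderiv_diff pderiv_mult)
  have D: "poly (pderiv (pair_form f g)) x = poly (pderiv (pair_form f g)) (x - 1) + poly (pderiv ?d) x" for x
    unfolding pair_form_def by (rule poly_pderiv_antidiff)
  have "poly (pderiv (pair_form f g)) (- 1) = - poly (pderiv (pair_form f g)) 0"
    using poly_pderiv_reflect[of "pair_form f g" "- 1"] pair_form_reflect[OF odd] by simp
  then have D0: "poly (pderiv (pair_form f g)) 0 = 0"
    using D[of 0] d[of 0] by simp
  have "poly (pderiv (pair_form f g)) (real i) = 0" if "i \<le> m" for i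
    using that
  proof (induction i)
    case (Suc i)
    then show ?case
      using D[of "real (Suc i)"] d[of "Suc i"] by simp
  qed (simp add: D0)
  then show ?thesis
    by simp
qed

lemma card_indices_ge: "m \<le> n \<Longrightarrow> (\<Sum>k\<in>{0..<n}. if m \<le> k then 1 else 0 :: nat) = n - m"
proof -
  have "{k. m \<le> k \<and> k < n} = {m..<n}"
    by auto
  then show ?thesis
    by (simp add: sum.If_cases Int_def conj_commute)
qed

lemma unsigned_chain_sum_poly:
  assumes "m \<le> n" and c: "c = real m \<or> c = - 1 - real m"
  shows "\<exists>P. (\<forall>N. poly P (real N) = chain_sum (\<lambda>l k. poly (vanishing_family m k) (real l)) N {0..<n})
    \<and> degree P \<le> n * (n + 1) \<and> [:- c, 1:] ^ (n - m) dvd P"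
proof -
  let ?q = "vanishing_family m"
  define w where "w = (\<lambda>k. if m \<le> k then 1 else 0 :: nat)"
  have deg: "degree (?q k) = 2 * k + 1" and odd: "poly (?q k) (- x) = - poly (?q k) x" for k x
    using odd_family_vanishing_family[of "Suc k" m] by (auto simp: odd_family_def)
  have F0: "poly (antidiff (?q k)) c = 0" if "m \<le> k" for k
  proof -
    have "poly (antidiff (?q k)) (real m) = 0"
      unfolding psum_poly[symmetric] using that by (intro psum_eq_0 vanishing_family_eq_0)
    then show ?thesis
      using c antidiff_reflect[of "?q k" "real m"] odd by auto
  qed
  have O_reflect: "poly (pair_form (?q k) (?q l)) (- 1 - x) = poly (pair_form (?q k) (?q l)) x" for k l x
    using pair_form_reflect[of "?q k" "?q l"] odd by (metis poly_reflect)
  have O0: "poly (pair_form (?q k) (?q l)) c = 0" if "m \<le> k" for k l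
  proof -
    have "poly (pair_form (?q k) (?q l)) (real m) = 0"
      unfolding pform_poly[symmetric] using that by (intro pform_eq_0 vanishing_family_eq_0)
    then show ?thesis
      using c O_reflect by auto
  qed
  have O0': "poly (pair_form (?q k) (?q l)) c = 0" if "m \<le> l" for k l
  proof -
    have "pform p N k l = - pform p N l k" for p N
      by (simp add: pform_def sum_negf[symmetric])
    then have "poly (pair_form (?q k) (?q l)) (real m) = 0"
      unfolding pform_poly[symmetric] using that pform_eq_0[of m "\<lambda>i k. poly (?q k) (real i)" l k]
      by (simp add: vanishing_family_eq_0)
    then show ?thesis
      using c O_reflect by auto
  qed
  have D0: "poly (pderiv (pair_form (?q k) (?q l))) c = 0" if "m \<le> k" "m \<le> l" for k l
  proof -
    have "poly (pderiv (pair_form (?q k) (?q l))) (real m) = 0"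
      using that by (intro pderiv_pair_form_eq_0) (auto simp: odd vanishing_family_eq_0)
    then show ?thesis
      using c poly_pderiv_reflect[of "pair_form (?q k) (?q l)" "real m"]
        pair_form_reflect[of "?q k" "?q l"] odd by auto
  qed
  have "\<exists>P. (\<forall>N. poly P (real N) = chain_sum (\<lambda>l k. poly (?q k) (real l)) N {0..<n})
      \<and> degree P \<le> (\<Sum>k\<in>{0..<n}. 2 * k + 2) \<and> [:- c, 1:] ^ sum w {0..<n} dvd P"
  proof (rule chain_sum_poly)
    show "poly (antidiff (?q k)) (real N) = psum (\<lambda>l k. poly (?q k) (real l)) N k" for k N
      by (simp add: psum_poly)
    show "poly (pair_form (?q k) (?q l)) (real N) = pform (\<lambda>l k. poly (?q k) (real l)) N k l" for k l N
      by (simp add: pform_poly)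
    show "degree (antidiff (?q k)) \<le> 2 * k + 2" for k
      using degree_antidiff[of "?q k"] by (simp add: deg)
    show "degree (pair_form (?q k) (?q l)) \<le> 2 * k + 2 + (2 * l + 2)" for k l
      using degree_pair_form[of "?q k" "?q l"] by (simp add: deg)
    show "[:- c, 1:] ^ w k dvd antidiff (?q k)" for k
      using F0[of k] by (simp add: w_def poly_eq_0_iff_dvd[symmetric])
    show "[:- c, 1:] ^ (w k + w l) dvd pair_form (?q k) (?q l)" for k l
    proof (cases "m \<le> k \<and> m \<le> l")
      case True
      then have "w k + w l = 2"
        by (simp add: w_def)
      then show ?thesis
        using True O0 D0 double_root_dvd by metis
    next
      case False
      then consider "w k + w l = 0" | "w k + w l = 1" "m \<le> k \<or> m \<le> l"
        by (cases "m \<le> k"; cases "m \<le> l"; simp add: w_def)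
      then show ?thesis
      proof cases
        case 2
        then have "[:- c, 1:] dvd pair_form (?q k) (?q l)"
          using O0 O0' by (auto simp only: poly_eq_0_iff_dvd[symmetric])
        then show ?thesis
          unfolding 2(1) power_one_right .
      qed simp
    qed
  qed auto
  moreover have "(\<Sum>k\<in>{0..<n}. 2 * k + 2) = n * (n + 1)"
    by (induction n) auto
  moreover have "sum w {0..<n} = n - m"
    using card_indices_ge[OF assms(1)] by (simp add: w_def)
  ultimately show ?thesis
    by simp
qed

lemma symplectic_tableaux_0: "symplectic_tableaux n 0 = {[]}"
proof -
  have "T = []" if "symplectic_tableau n T" "width T = 0" for T
    using that by (cases T) (auto simp: symplectic_tableau_def semistandard_def is_partition_def
        shape_def width_def)
  moreover have "symplectic_tableau n []"
    by (simp add: symplectic_tableau_def semistandard_def is_partition_def shape_def)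
  ultimately show ?thesis
    by (auto simp: symplectic_tableaux_def height_def width_def)
qed

lemma dvd_prod_imp_eq:
  fixes Z Q :: "real poly"
  assumes "Q dvd Z" "degree Z \<le> degree Q"
  shows "\<exists>a. Z = smult a Q"
proof (cases "Z = 0")
  case False
  obtain R where R: "Z = Q * R"
    using assms(1) by auto
  then have "degree R = 0"
    using False assms(2) by (auto simp: degree_mult_eq)
  then obtain a where "R = [:a:]"
    by (rule degree_eq_zeroE)
  then show ?thesis
    using R by (intro exI[of _ a]) simp
qed (auto intro: exI[of _ 0])

text \<open>The polynomials of two families are proportional at all \<open>N \<ge> n\<close>, hence
  everywhere, which carries every divisor \<open>[:- c, 1:] ^ (n - m)\<close> over to
  \<open>P0\<close>. The divisors belong to distinct points and together reach the degree bound, so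
  only a scalar \<open>a\<close> is left.\<close>

lemma unsigned_count_poly:
  "\<exists>a. \<forall>r. real (card (symplectic_tableaux n r)) =
     a * (\<Prod>m<n. ((real n + real r - real m) * (real n + real r + real m + 1)) ^ (n - m))"
proof -
  define W where "W r = real (card (symplectic_tableaux n r))" for r
  have fam: "\<exists>C P. C \<noteq> 0 \<and> (\<forall>r. poly P (real (n + r)) = C * W r) \<and> degree P \<le> n * (n + 1)
      \<and> [:- c, 1:] ^ (n - m) dvd P"
    if mc: "m \<le> n" "c = real m \<or> c = - 1 - real m" for m c
  proof -
    obtain P where P: "\<And>N. poly P (real N) = chain_sum (\<lambda>l k. poly (vanishing_family m k) (real l)) N {0..<n}"
        "degree P \<le> n * (n + 1)" "[:- c, 1:] ^ (n - m) dvd P"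
      using unsigned_chain_sum_poly[OF mc] by blast
    obtain C :: real where C: "C \<noteq> 0" "\<And>g r. chain_sum (\<lambda>l k. g ^ l * poly (vanishing_family m k) (real l))
        (n + r) {0..<n} = C * g ^ \<Sum>{1..n} * (\<Sum>T \<in> symplectic_tableaux n r. g ^ num_squares T)"
      using chain_sum_eq_tableaux[OF odd_family_vanishing_family] by blast
    have "poly P (real (n + r)) = C * W r" for r
      using C(2)[of 1 r] P(1)[of "n + r"] by (simp add: W_def)
    then show ?thesis
      using C(1) P by blast
  qed
  obtain C0 P0 where P0: "C0 \<noteq> 0" "\<And>r. poly P0 (real (n + r)) = C0 * W r" "degree P0 \<le> n * (n + 1)"
    using fam[of 0 0] by auto
  have dvd: "[:- c, 1:] ^ (n - m) dvd P0" if mc: "m < n" "c = real m \<or> c = - 1 - real m" for m c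
  proof -
    obtain C P where P: "C \<noteq> 0" "\<And>r. poly P (real (n + r)) = C * W r" "[:- c, 1:] ^ (n - m) dvd P"
      using fam[of m c] mc by auto
    have "smult C P0 = smult C0 P"
      by (rule poly_eqI_inj[of "\<lambda>r. real (n + r)"]) (simp_all add: inj_def P(2) P0(2) del: of_nat_add)
    then show ?thesis
      using P(1,3) by (metis dvd_smult dvd_smult_cancel)
  qed
  let ?a = "\<lambda>i. if snd i then real (fst i) else - 1 - real (fst i)"
  define Q where "Q = (\<Prod>i \<in> {..<n} \<times> UNIV. [:- ?a i, 1:] ^ (n - fst i))"
  have "Q dvd P0"
    unfolding Q_def
  proof (rule prod_linear_powers_dvd)
    show "inj_on ?a ({..<n} \<times> UNIV)"
      by (auto simp: inj_on_def split: if_splits)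
    show "[:- ?a i, 1:] ^ (n - fst i) dvd P0" if "i \<in> {..<n} \<times> UNIV" for i
      by (rule dvd) (use that in auto)
  qed simp
  moreover have "degree Q = n * (n + 1)"
  proof -
    have "degree Q = (\<Sum>i \<in> {..<n} \<times> (UNIV :: bool set). degree ([:- ?a i, 1:] ^ (n - fst i)))"
      unfolding Q_def by (intro degree_prod_eq_sum_degree) auto
    also have "\<dots> = (\<Sum>i \<in> {..<n} \<times> (UNIV :: bool set). n - fst i)"
      by (intro sum.cong refl) (simp add: degree_power_eq)
    also have "\<dots> = (\<Sum>m<n. \<Sum>b\<in>(UNIV :: bool set). n - m)"
      by (simp only: sum.cartesian_product case_prod_unfold)
    also have "\<dots> = (\<Sum>m<n. 2 * (n - m))"
      by simp
    also have "\<dots> = (\<Sum>m<n. 2 * Suc m)"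
      by (rule sum.nat_diff_reindex[symmetric, THEN trans]) (auto intro!: sum.cong)
    also have "\<dots> = n * (n + 1)"
      by (induction n) auto
    finally show ?thesis .
  qed
  ultimately obtain a where a: "P0 = smult a Q"
    using dvd_prod_imp_eq[of Q P0] P0(3) by auto
  have "poly Q x = (\<Prod>m<n. ((x - real m) * (x + real m + 1)) ^ (n - m))" for x
  proof -
    have "poly Q x = (\<Prod>m<n. \<Prod>b\<in>UNIV. (x - (if b then real m else - 1 - real m)) ^ (n - m))"
      by (simp add: Q_def poly_prod prod.cartesian_product case_prod_unfold)
    moreover have "x - (- 1 - real m) = x + real m + 1" for m
      by simp
    ultimately show ?thesis
      by (simp add: UNIV_bool power_mult_distrib mult.commute)
  qed
  then have "W r = (a / C0) * (\<Prod>m<n. ((real n + real r - real m) * (real n + real r + real m + 1)) ^ (n - m))" for r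
    using P0(1) P0(2)[of r] by (simp add: a eq_divide_eq mult.commute)
  then show ?thesis
    unfolding W_def by blast
qed

section \<open>The signed sum\<close>

text \<open>Summation of \<open>(-1)^l * f l\<close> for an odd polynomial \<open>f\<close> produces different polynomials in \<open>N\<close> for
  even and odd \<open>N\<close>; both are the same polynomial in \<open>tau N\<close>.\<close>

definition tau :: "nat \<Rightarrow> real" where
  "tau N = (if even N then real N else - 1 - real N)"

lemma inj_tau: "inj tau"
proof (rule injI)
  fix M N assume eq: "tau M = tau N"
  show "M = N"
  proof (cases "even M \<longleftrightarrow> even N")
    case True
    then show ?thesis
      using eq by (auto simp: tau_def split: if_splits)
  next
    case False
    have "0 \<le> tau N \<longleftrightarrow> even N" for N
      by (simp add: tau_def)
    then show ?thesis
      using False eq by metis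
  qed
qed

lemma antisym_tau:
  assumes "\<And>x. poly h (- 1 - x) = - poly h x"
  shows "poly h (tau N) = (- 1) ^ N * poly h (real N)"
  using assms by (simp add: tau_def)

section \<open>Alternating summation by antisymmetric polynomials\<close>

lemma half_sum_surj:
  fixes f :: "real poly"
  assumes "\<And>i. i \<ge> d \<Longrightarrow> coeff f i = 0"
  shows "\<exists>h. h + shift h = f \<and> degree h \<le> d - 1"
  using assms
proof (induction d arbitrary: f)
  case 0
  then have "f = 0"
    by (intro poly_eqI) simp
  then show ?case
    by (intro exI[of _ 0]) simp
next
  case (Suc d)
  define h0 where "h0 = monom (coeff f d / 2) d"
  have h0: "degree h0 \<le> d"
    by (simp add: h0_def degree_monom_le)
  have "coeff (f - (h0 + shift h0)) i = 0" if "i \<ge> d" for i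
  proof (cases "i = d")
    case True
    then show ?thesis
      using coeff_shift_top[OF h0, of "- 1"] by (simp add: h0_def)
  next
    case False
    then have "coeff h0 i = 0" "coeff (shift h0) i = 0"
      using that h0 by (auto intro!: coeff_eq_0)
    then show ?thesis
      using False that Suc.prems[of i] by simp
  qed
  then obtain h1 where h1: "h1 + shift h1 = f - (h0 + shift h0)" "degree h1 \<le> d - 1"
    using Suc.IH by blast
  show ?case
  proof (intro exI conjI)
    show "(h0 + h1) + shift (h0 + h1) = f"
      using h1(1) by (simp add: pcompose_add algebra_simps)
    show "degree (h0 + h1) \<le> Suc d - 1"
      using h0 h1(2) by (intro degree_add_le) auto
  qed
qed

text \<open>With \<open>f x = h x + h (x - 1)\<close> the alternating sum of \<open>f\<close>
  telescopes to \<open>(- 1) ^ N * h N - h 0\<close>. Because \<open>f\<close> is odd,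
  \<open>h\<close> can be made antisymmetric about \<open>- 1 / 2\<close>, which turns the first
  term into \<open>h (tau N)\<close>.\<close>

lemma half_sum_exists:
  fixes f :: "real poly"
  assumes "\<And>x. poly f (- x) = - poly f x"
  shows "\<exists>h. h + shift h = f \<and> (\<forall>x. poly h (- 1 - x) = - poly h x) \<and> degree h \<le> degree f"
proof -
  obtain h where h: "h + shift h = f" "degree h \<le> degree f"
    using half_sum_surj[of "Suc (degree f)" f] by (auto simp: coeff_eq_0)
  let ?g = "smult (1 / 2) (h - reflect h)"
  have f: "poly f x = poly h x + poly h (x - 1)" for x
    by (simp add: h(1)[symmetric])
  have "?g + shift ?g = f"
  proof (rule poly_ext)
    fix x :: real
    have e: "- 1 - (x - 1) = - x" "- 1 - x = - x - 1"
      by auto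
    have "poly (?g + shift ?g) x = (poly h x - poly h (- 1 - x)) / 2 +
        (poly h (x - 1) - poly h (- 1 - (x - 1))) / 2"
      by simp
    also have "\<dots> = poly f x"
      unfolding e using assms[of x] f[of x] f[of "- x"] by (simp add: field_simps)
    finally show "poly (?g + shift ?g) x = poly f x" .
  qed
  moreover have "poly ?g (- 1 - x) = - poly ?g x" for x
    by (simp add: field_simps)
  moreover have "degree ?g \<le> degree f"
    using h(2) by (simp add: degree_diff_le)
  ultimately show ?thesis
    by blast
qed

definition psi :: "real poly \<Rightarrow> real poly \<Rightarrow> real poly" where
  "psi f g = antidiff (f * shift g - g * shift f)"

text \<open>The entry of the signed Pfaffian in the variable \<open>tau N\<close>. Adjacent signs
  multiply to -1 and give \<open>- psi f g\<close>; the linear terms come from the constants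
  \<open>f 0\<close> and \<open>g 0\<close> left over by the inner alternating sums.\<close>

definition alt_pair_form :: "real poly \<Rightarrow> real poly \<Rightarrow> real poly" where
  "alt_pair_form f g = - psi f g - smult (poly g 0) f + smult (poly f 0) g"

definition antisym :: "real poly \<Rightarrow> bool" where
  "antisym h \<longleftrightarrow> (\<forall>x. poly h (- 1 - x) = - poly h x)"

lemma antisymD: "antisym h \<Longrightarrow> poly h (- 1 - x) = - poly h x"
  by (simp add: antisym_def)

lemma antisym_minus: "antisym h \<Longrightarrow> poly h (- x) = - poly h (x - 1)"
  using antisymD[of h "x - 1"] by simp

lemma antisym_minus_1: "antisym h \<Longrightarrow> poly h (- x - 1) = - poly h x"
  using antisymD[of h x] by (metis minus_diff_commute)

lemma antisym_pderiv: "antisym h \<Longrightarrow> poly (pderiv h) (- 1 - x) = poly (pderiv h) x"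
proof -
  assume "antisym h"
  then have "reflect h = - h"
    by (intro poly_ext) (simp add: antisymD)
  then show ?thesis
    using poly_pderiv_reflect[of h x] by (simp add: pderiv_minus)
qed

lemma psi_rec: "poly (psi f g) x = poly (psi f g) (x - 1) + (poly f x * poly g (x - 1) - poly g x * poly f (x - 1))"
  unfolding psi_def by (subst antidiff) simp

lemma psi_0 [simp]: "poly (psi f g) 0 = 0"
  by (simp add: psi_def)

lemma psi_reflect:
  assumes "antisym f" "antisym g"
  shows "reflect (psi f g) = psi f g"
  unfolding psi_def
proof (rule antidiff_unique)
  let ?d = "f * shift g - g * shift f"
  fix x
  have "poly ?d (- x) = - poly ?d x"
    by (simp add: antisym_minus[OF assms(1)] antisym_minus[OF assms(2)]
        antisym_minus_1[OF assms(1)] antisym_minus_1[OF assms(2)])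
  then have "poly (antidiff ?d) (- x) = poly (antidiff ?d) (- x - 1) - poly ?d x"
    using antidiff[of ?d "- x"] by simp
  moreover have "- 1 - (x - 1) = - x" "- x - 1 = - 1 - x"
    by auto
  ultimately show "poly (reflect (antidiff ?d)) x = poly (reflect (antidiff ?d)) (x - 1) + poly ?d x"
    by (simp only: poly_reflect)
next
  show "poly (reflect (antidiff (f * shift g - g * shift f))) 0 = 0"
    using antidiff[of "f * shift g - g * shift f" 0] antisym_minus[OF assms(1), of 0]
      antisym_minus[OF assms(2), of 0] by simp
qed

lemma poly_psi_reflect: "antisym f \<Longrightarrow> antisym g \<Longrightarrow> poly (psi f g) (- 1 - x) = poly (psi f g) x"
  using psi_reflect[of f g] by (metis poly_reflect)

lemma poly_psi_tau: "antisym f \<Longrightarrow> antisym g \<Longrightarrow> poly (psi f g) (tau N) = poly (psi f g) (real N)"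
  by (simp add: tau_def poly_psi_reflect)

lemma psum_alt_poly:
  assumes "antisym (h k)"
  shows "psum (\<lambda>l k. (- 1) ^ l * poly (h k + shift (h k)) (real l)) N k =
    poly (h k - [:poly (h k) 0:]) (tau N)"
proof (induction N)
  case 0
  then show ?case
    by (simp add: tau_def)
next
  case (Suc N)
  then show ?case
    by (simp add: psum_Suc antisym_tau[OF antisymD[OF assms]] algebra_simps)
qed

lemma pform_alt_poly:
  assumes "antisym (h k)" "antisym (h l)"
  shows "pform (\<lambda>l k. (- 1) ^ l * poly (h k + shift (h k)) (real l)) N k l =
    poly (alt_pair_form (h k) (h l)) (tau N)"
proof (induction N)
  case 0
  then show ?case
    by (simp add: tau_def alt_pair_form_def)
next
  case (Suc N)
  have "(- 1 :: real) ^ N * (- 1) ^ N = 1"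
    by (simp add: power_add[symmetric])
  then have sq: "(- 1 :: real) ^ N * ((- 1) ^ N * z) = z" for z
    by (metis mult.assoc mult_1)
  show ?case
    unfolding pform_Suc Suc.IH psum_alt_poly[of h k, OF assms(1)] psum_alt_poly[of h l, OF assms(2)]
    using psi_rec[of "h k" "h l" "real (Suc N)"]
    by (simp add: assms alt_pair_form_def poly_psi_tau antisym_tau[OF antisymD] algebra_simps sq)
qed

text \<open>The leading terms of \<open>f * shift g\<close> and \<open>g * shift f\<close> cancel,
  which makes up for the degree gained by summation.\<close>

lemma degree_psi:
  assumes "degree f \<le> Suc a" "degree g \<le> Suc b"
  shows "degree (psi f g) \<le> Suc a + Suc b"
proof -
  have shift_diff: "degree (shift h - h) \<le> d" if "degree h \<le> Suc d" for h :: "real poly" and d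
  proof -
    have "shift h - h = - shift (pcompose h [:1, 1:] - h)"
      by (rule poly_ext) (simp add: poly_pcompose)
    then show ?thesis
      using forward_difference_top[OF that] by simp
  qed
  have "f * shift g - g * shift f = f * (shift g - g) - g * (shift f - f)"
    by (simp add: algebra_simps)
  moreover have "degree (f * (shift g - g)) \<le> Suc a + b"
    using degree_mult_le[of f "shift g - g"] assms(1) shift_diff[OF assms(2)] by linarith
  moreover have "degree (g * (shift f - f)) \<le> Suc b + a"
    using degree_mult_le[of g "shift f - f"] assms(2) shift_diff[OF assms(1)] by linarith
  ultimately have "degree (f * shift g - g * shift f) \<le> Suc (a + b)"
    by (auto intro: degree_diff_le)
  then show ?thesis
    unfolding psi_def using degree_antidiff[of "f * shift g - g * shift f"] by simp
qed

lemma degree_alt_pair_form: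
  assumes "degree f \<le> Suc a" "degree g \<le> Suc b"
  shows "degree (alt_pair_form f g) \<le> Suc a + Suc b"
  unfolding alt_pair_form_def
proof (intro degree_add_le degree_diff_le)
  show "degree (- psi f g) \<le> Suc a + Suc b"
    using degree_psi[OF assms] by simp
qed (use assms in \<open>auto intro: order_trans[OF degree_smult_le]\<close>)

lemma poly_pderiv_psi_rec:
  "poly (pderiv (psi f g)) x = poly (pderiv (psi f g)) (x - 1) +
    (poly (pderiv f) x * poly g (x - 1) + poly f x * poly (pderiv g) (x - 1)
     - poly (pderiv g) x * poly f (x - 1) - poly g x * poly (pderiv f) (x - 1))"
  unfolding psi_def by (subst poly_pderiv_antidiff) (simp add: pderiv_diff pderiv_mult algebra_simps)

lemma pderiv_psi_reflect:
  "antisym f \<Longrightarrow> antisym g \<Longrightarrow> poly (pderiv (psi f g)) (- 1 - x) = - poly (pderiv (psi f g)) x"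
  using poly_pderiv_reflect[of "psi f g" x] psi_reflect[of f g] by simp

text \<open>By reflection the derivatives at \<open>-1\<close> and \<open>0\<close> are opposite, so
  the recursion at 0 determines the value.\<close>

lemma pderiv_psi_0:
  assumes "antisym f" "antisym g"
  shows "poly (pderiv (psi f g)) 0 = poly f 0 * poly (pderiv g) 0 - poly (pderiv f) 0 * poly g 0"
  using poly_pderiv_psi_rec[of f g 0] pderiv_psi_reflect[OF assms, of 0]
    antisym_minus[OF assms(1), of 0] antisym_minus[OF assms(2), of 0]
    antisymD[OF assms(1), of 0] antisymD[OF assms(2), of 0]
    antisym_pderiv[OF assms(1), of 0] antisym_pderiv[OF assms(2), of 0]
  by simp

text \<open>By reflection, the derivative at \<open>tau N\<close> is up to sign the quantity \<open>D N\<close> in the proof, which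
  does not depend on \<open>N\<close> as long as both summands vanish.\<close>

lemma pderiv_alt_pair_form_tau_eq_0:
  assumes as: "antisym f" "antisym g"
    and zero: "\<And>i. i \<le> m \<Longrightarrow> poly (f + shift f) (real i) = 0"
      "\<And>i. i \<le> m \<Longrightarrow> poly (g + shift g) (real i) = 0"
  shows "poly (pderiv (alt_pair_form f g)) (tau m) = 0"
proof -
  define D where "D N = - poly (pderiv (psi f g)) (real N)
      - (- 1) ^ N * (poly g 0 * poly (pderiv f) (real N) - poly f 0 * poly (pderiv g) (real N))" for N
  have pderiv_tau: "poly (pderiv h) (tau N) = poly (pderiv h) (real N)" if "antisym h" for h N
    using antisym_pderiv[OF that] by (simp add: tau_def)
  have D: "poly (pderiv (alt_pair_form f g)) (tau N) = (- 1) ^ N * D N" for N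
    using pderiv_psi_reflect[OF as, of "real N"]
    by (cases "even N")
      (simp_all add: D_def alt_pair_form_def pderiv_add pderiv_diff pderiv_minus pderiv_smult
        pderiv_tau as, simp_all add: tau_def)
  have val: "poly h (real i) = (- 1) ^ i * poly h 0"
    if "\<And>i. i \<le> m \<Longrightarrow> poly (h + shift h) (real i) = 0" "i \<le> m" for h :: "real poly" and i
    using that(2)
  proof (induction i)
    case (Suc i)
    then show ?case
      using that(1)[of "Suc i"] by simp
  qed simp
  have "D N = 0" if "N \<le> m" for N
    using that
  proof (induction N)
    case 0
    then show ?case
      by (simp add: D_def pderiv_psi_0 as)
  next
    case (Suc N)
    \<comment> \<open>The values of \<open>f\<close> and \<open>g\<close> alternate in sign up to
      \<open>m\<close>, so the increment of the derivative of \<open>psi f g\<close> is exactly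
      offset by the change in the linear terms.\<close>
    have "D (Suc N) = D N"
      using poly_pderiv_psi_rec[of f g "real (Suc N)"] Suc.prems
        val[OF zero(1), of N] val[OF zero(1), of "Suc N"] val[OF zero(2), of N] val[OF zero(2), of "Suc N"]
      by (simp add: D_def algebra_simps)
    then show ?case
      using Suc by simp
  qed
  then show ?thesis
    by (simp add: D)
qed

lemma psi_eq_0:
  assumes "\<And>i. i \<le> m \<Longrightarrow> poly f (real i) = 0" "N \<le> m"
  shows "poly (psi f g) (real N) = 0"
  using assms(2)
proof (induction N)
  case (Suc N)
  then show ?case
    using psi_rec[of f g "real (Suc N)"] assms(1)[of N] assms(1)[of "Suc N"] by simp
qed simp

lemma pderiv_psi_eq_0:
  assumes "antisym f" "antisym g"
    and "\<And>i. i \<le> m \<Longrightarrow> poly f (real i) = 0" "\<And>i. i \<le> m \<Longrightarrow> poly g (real i) = 0" "N \<le> m"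
  shows "poly (pderiv (psi f g)) (real N) = 0"
  using assms(5)
proof (induction N)
  case 0
  then show ?case
    using assms(3)[of 0] assms(4)[of 0] by (simp add: pderiv_psi_0 assms)
next
  case (Suc N)
  then show ?case
    using poly_pderiv_psi_rec[of f g "real (Suc N)"] assms(3)[of N] assms(3)[of "Suc N"]
      assms(4)[of N] assms(4)[of "Suc N"] by simp
qed

lemma psi_swap: "psi f g = - psi g f"
proof -
  have "- psi g f = antidiff (f * shift g - g * shift f)"
  proof (rule antidiff_unique)
    show "poly (- psi g f) x = poly (- psi g f) (x - 1) + poly (f * shift g - g * shift f) x" for x
      using psi_rec[of g f x] by simp
  qed simp
  then show ?thesis
    by (simp add: psi_def)
qed

lemma alt_pair_form_swap: "alt_pair_form f g = - alt_pair_form g f"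
  using psi_swap[of f g] by (simp add: alt_pair_form_def)

text \<open>The point \<open>c\<close> is left open because the zeros at \<open>tau m\<close> and at
  \<open>- 1 - tau m\<close> need different families \<open>h\<close> and different reasons for
  vanishing.\<close>

lemma signed_chain_sum_poly:
  assumes h: "\<And>k. antisym (h k)" "\<And>k. degree (h k) \<le> 2 * k + 1"
    and F0: "\<And>k. m \<le> k \<Longrightarrow> poly (h k) c = poly (h k) 0"
    and O0: "\<And>k l. m \<le> k \<Longrightarrow> poly (alt_pair_form (h k) (h l)) c = 0"
    and D0: "\<And>k l. m \<le> k \<Longrightarrow> m \<le> l \<Longrightarrow> poly (pderiv (alt_pair_form (h k) (h l))) c = 0"
    and "m \<le> n"
  shows "\<exists>P. (\<forall>N. poly P (tau N) =
      chain_sum (\<lambda>l k. (- 1) ^ l * poly (h k + shift (h k)) (real l)) N {0..<n})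
    \<and> degree P \<le> n * n \<and> [:- c, 1:] ^ (n - m) dvd P"
proof -
  let ?p = "\<lambda>l k. (- 1) ^ l * poly (h k + shift (h k)) (real l)"
  define w where "w = (\<lambda>k. if m \<le> k then 1 else 0 :: nat)"
  have "\<exists>P. (\<forall>N. poly P (tau N) = chain_sum ?p N {0..<n})
      \<and> degree P \<le> (\<Sum>k\<in>{0..<n}. 2 * k + 1) \<and> [:- c, 1:] ^ sum w {0..<n} dvd P"
  proof (rule chain_sum_poly)
    show "poly (h k - [:poly (h k) 0:]) (tau N) = psum ?p N k" for k N
      by (rule psum_alt_poly[symmetric]) (rule h)
    show "poly (alt_pair_form (h k) (h l)) (tau N) = pform ?p N k l" for k l N
      by (rule pform_alt_poly[symmetric]) (rule h)+
    show "degree (h k - [:poly (h k) 0:]) \<le> 2 * k + 1" for k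
      using h(2) by (intro degree_diff_le) auto
    show "degree (alt_pair_form (h k) (h l)) \<le> 2 * k + 1 + (2 * l + 1)" for k l
      using degree_alt_pair_form[of "h k" "2 * k" "h l" "2 * l"] h(2)[of k] h(2)[of l] by simp
    show "[:- c, 1:] ^ w k dvd h k - [:poly (h k) 0:]" for k
      using F0[of k] by (simp add: w_def poly_eq_0_iff_dvd[symmetric])
    show "[:- c, 1:] ^ (w k + w l) dvd alt_pair_form (h k) (h l)" for k l
    proof (cases "m \<le> k \<and> m \<le> l")
      case True
      then have "w k + w l = 2"
        by (simp add: w_def)
      then show ?thesis
        using True O0 D0 double_root_dvd by metis
    next
      case False
      then consider "w k + w l = 0" | "w k + w l = 1" "m \<le> k \<or> m \<le> l"
        by (cases "m \<le> k"; cases "m \<le> l"; simp add: w_def)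
      then show ?thesis
      proof cases
        case 2
        have "poly (alt_pair_form (h k) (h l)) c = 0"
          using 2(2) O0[of k l] O0[of l k] alt_pair_form_swap[of "h k" "h l"] by auto
        then have "[:- c, 1:] dvd alt_pair_form (h k) (h l)"
          by (simp only: poly_eq_0_iff_dvd)
        then show ?thesis
          unfolding 2(1) power_one_right .
      qed simp
    qed
  qed auto
  moreover have "(\<Sum>k\<in>{0..<n}. 2 * k + 1) = n * n"
    by (induction n) auto
  moreover have "sum w {0..<n} = n - m"
    using card_indices_ge[OF assms(6)] by (simp add: w_def)
  ultimately show ?thesis
    by simp
qed

text \<open>Here the summands with \<open>k \<ge> m\<close> vanish at \<open>0, ..., m\<close>, so
  at \<open>N = m\<close> their sums have only zero terms; \<open>h\<close> itself need not vanish
  there.\<close>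

lemma signed_family_tau:
  assumes "m \<le> n"
  shows "\<exists>q P. odd_family 0 n q \<and>
    (\<forall>N. poly P (tau N) = chain_sum (\<lambda>l k. (- 1) ^ l * poly (q k) (real l)) N {0..<n})
    \<and> degree P \<le> n * n \<and> [:- tau m, 1:] ^ (n - m) dvd P"
proof -
  let ?q = "vanishing_family m"
  have deg: "degree (?q k) = 2 * k + 1" and odd: "poly (?q k) (- x) = - poly (?q k) x" for k x
    using odd_family_vanishing_family[of "Suc k" m] by (auto simp: odd_family_def)
  have "\<exists>h. h + shift h = ?q k \<and> (\<forall>x. poly h (- 1 - x) = - poly h x) \<and> degree h \<le> degree (?q k)" for k
    by (rule half_sum_exists) (rule odd)
  then obtain h where h: "\<And>k. h k + shift (h k) = ?q k" "\<And>k. antisym (h k)"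
      "\<And>k. degree (h k) \<le> 2 * k + 1"
    unfolding antisym_def deg by metis
  have zero: "poly (h k + shift (h k)) (real i) = 0" if "m \<le> k" "i \<le> m" for k i
    using that by (simp only: h(1) vanishing_family_eq_0)
  have "\<exists>P. (\<forall>N. poly P (tau N) =
      chain_sum (\<lambda>l k. (- 1) ^ l * poly (h k + shift (h k)) (real l)) N {0..<n})
    \<and> degree P \<le> n * n \<and> [:- tau m, 1:] ^ (n - m) dvd P"
  proof (rule signed_chain_sum_poly[OF h(2,3)])
    fix k assume k: "m \<le> k"
    have "psum (\<lambda>l k. (- 1) ^ l * poly (h k + shift (h k)) (real l)) m k = 0"
      using zero[OF k] by (intro psum_eq_0) simp
    then show "poly (h k) (tau m) = poly (h k) 0"
      by (simp add: psum_alt_poly h(2) del: poly_add poly_shift)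
    fix l
    have "pform (\<lambda>l k. (- 1) ^ l * poly (h k + shift (h k)) (real l)) m k l = 0"
      using zero[OF k] by (intro pform_eq_0) simp
    then show "poly (alt_pair_form (h k) (h l)) (tau m) = 0"
      by (simp add: pform_alt_poly h(2) del: poly_add poly_shift)
    assume "m \<le> l"
    then show "poly (pderiv (alt_pair_form (h k) (h l))) (tau m) = 0"
      using k zero by (intro pderiv_alt_pair_form_tau_eq_0 h(2))
  qed (rule assms)
  then show ?thesis
    unfolding h(1) using odd_family_vanishing_family[of n m] by blast
qed

text \<open>The zeros at \<open>- 1 - tau m\<close> are not seen by the sum itself, as \<open>tau\<close> takes only even integer
  values. They come from making the summation polynomials, rather than the summands, vanish.\<close>

definition antisym_family :: "nat \<Rightarrow> nat \<Rightarrow> real poly" where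
  "antisym_family m k = (if k \<le> m then [:1 / 2, 1:] ^ (2 * k + 1)
     else [:1 / 2, 1:] ^ (2 * (k - m) - 1) * (\<Prod>i\<in>{0..m}. [:- (real i * (real i + 1)), 1, 1:]))"

lemma antisym_antisym_family: "antisym (antisym_family m k)"
proof -
  have odd: "poly ([:1 / 2, 1:] ^ d) (- 1 - x) = - poly ([:1 / 2, 1:] ^ d) x" if "odd d" for d and x :: real
  proof -
    have "poly [:1 / 2, 1:] (- 1 - x) = - (1 / 2 + x)"
      by simp
    then have "poly ([:1 / 2, 1:] ^ d) (- 1 - x) = (- (1 / 2 + x)) ^ d"
      by (simp only: poly_power)
    also have "\<dots> = - ((1 / 2 + x) ^ d)"
      using that by (rule power_minus_odd)
    finally show ?thesis
      by (simp add: poly_power)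
  qed
  have even: "poly (\<Prod>i\<in>{0..m}. [:- (real i * (real i + 1)), 1, 1:]) (- 1 - x) =
      poly (\<Prod>i\<in>{0..m}. [:- (real i * (real i + 1)), 1, 1:]) x" for x
    by (simp add: poly_prod algebra_simps)
  show ?thesis
  proof (cases "k \<le> m")
    case True
    then show ?thesis
      using odd[of "2 * k + 1"] by (simp add: antisym_def antisym_family_def del: power_Suc poly_power)
  next
    case False
    then have "odd (2 * (k - m) - 1)"
      by simp
    then show ?thesis
      using False odd even
      by (simp add: antisym_def antisym_family_def poly_mult del: power_Suc poly_power mult_pCons_left)
  qed
qed

lemma degree_antisym_family: "degree (antisym_family m k) = 2 * k + 1"
proof (cases "k \<le> m")
  case False
  have "degree (\<Prod>i\<in>{0..m}. [:- (real i * (real i + 1)), 1, 1:]) =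
      (\<Sum>i\<in>{0..m}. degree [:- (real i * (real i + 1)), 1, 1:])"
    by (intro degree_prod_eq_sum_degree) auto
  then have "degree (\<Prod>i\<in>{0..m}. [:- (real i * (real i + 1)), 1, 1:]) = 2 * (m + 1)"
    by simp
  moreover have "(\<Prod>i\<in>{0..m}. [:- (real i * (real i + 1)), 1, 1:]) \<noteq> 0"
    by auto
  ultimately show ?thesis
    using False by (simp add: antisym_family_def degree_mult_eq degree_power_eq)
qed (simp add: antisym_family_def degree_power_eq del: power_Suc)

lemma antisym_family_eq_0:
  assumes "m < k" "i \<le> m"
  shows "poly (antisym_family m k) (real i) = 0"
proof -
  have "poly [:- (real i * (real i + 1)), 1, 1:] (real i) = 0"
    by (simp add: algebra_simps)
  then have "(\<Prod>j\<in>{0..m}. poly [:- (real j * (real j + 1)), 1, 1:] (real i)) = 0"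
    using assms(2) by (intro prod_zero bexI[of _ i]) auto
  then show ?thesis
    using assms(1) by (simp add: antisym_family_def poly_prod del: poly_pCons)
qed

lemma odd_family_antisym_family: "odd_family 0 n (\<lambda>k. antisym_family m k + shift (antisym_family m k))"
proof -
  let ?h = "antisym_family m"
  have "degree (?h k + shift (?h k)) = 2 * k + 1" for k
  proof (rule antisym)
    show "degree (?h k + shift (?h k)) \<le> 2 * k + 1"
      by (intro degree_add_le) (simp_all add: degree_antisym_family)
    have "?h k \<noteq> 0"
      using degree_antisym_family[of m k] by auto
    then have "coeff (?h k) (2 * k + 1) \<noteq> 0"
      using leading_coeff_neq_0[of "?h k"] by (simp add: degree_antisym_family)
    then have "coeff (?h k + shift (?h k)) (2 * k + 1) \<noteq> 0"
      using coeff_shift_top[of "?h k" "2 * k + 1" "- 1"] by (simp add: degree_antisym_family)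
    then show "2 * k + 1 \<le> degree (?h k + shift (?h k))"
      by (rule le_degree)
  qed
  moreover have "poly (?h k + shift (?h k)) (- x) = - poly (?h k + shift (?h k)) x" for k x
    by (simp add: antisym_minus[OF antisym_antisym_family] antisym_minus_1[OF antisym_antisym_family])
  ultimately show ?thesis
    by (simp add: odd_family_def)
qed

text \<open>The polynomials with index above \<open>m\<close> vanish at \<open>0, ..., m\<close> and
  at the reflected points. This takes \<open>m + 1\<close> quadratic factors besides an odd power of
  \<open>x + 1 / 2\<close>, one more than for odd polynomials in \<open>x\<close>, whose zero at 0
  is free; hence the exponent \<open>n - Suc m\<close>.\<close>

lemma signed_family_opposite:
  assumes "m < n"
  shows "\<exists>q P. odd_family 0 n q \<and>
    (\<forall>N. poly P (tau N) = chain_sum (\<lambda>l k. (- 1) ^ l * poly (q k) (real l)) N {0..<n})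
    \<and> degree P \<le> n * n \<and> [:- (- 1 - tau m), 1:] ^ (n - Suc m) dvd P"
proof -
  let ?h = "antisym_family m" and ?c = "- 1 - tau m"
  note as = antisym_antisym_family[of m]
  have c: "?c = real m \<or> ?c = - 1 - real m"
    by (simp add: tau_def)
  have h_c: "poly (?h k) ?c = 0" if "Suc m \<le> k" for k
    using c antisymD[OF as, of k "real m"] antisym_family_eq_0[of m k m] that by auto
  have h_0: "poly (?h k) 0 = 0" if "Suc m \<le> k" for k
    using antisym_family_eq_0[of m k 0] that by simp
  have "\<exists>P. (\<forall>N. poly P (tau N) =
      chain_sum (\<lambda>l k. (- 1) ^ l * poly (?h k + shift (?h k)) (real l)) N {0..<n})
    \<and> degree P \<le> n * n \<and> [:- ?c, 1:] ^ (n - Suc m) dvd P"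
  proof (rule signed_chain_sum_poly[OF as])
    fix k assume k: "Suc m \<le> k"
    then show "poly (?h k) ?c = poly (?h k) 0"
      by (simp only: h_c h_0)
    fix l
    have "poly (psi (?h k) (?h l)) (real m) = 0"
      using k by (intro psi_eq_0[of m] antisym_family_eq_0) auto
    then have "poly (psi (?h k) (?h l)) ?c = 0"
      using c by (elim disjE) (simp_all only: poly_psi_reflect[OF as as])
    then show "poly (alt_pair_form (?h k) (?h l)) ?c = 0"
      by (simp add: alt_pair_form_def h_c[OF k] h_0[OF k])
    assume l: "Suc m \<le> l"
    have "poly (pderiv (psi (?h k) (?h l))) (real m) = 0"
      using k l by (intro pderiv_psi_eq_0[of _ _ m] as antisym_family_eq_0) auto
    then have "poly (pderiv (psi (?h k) (?h l))) ?c = 0"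
      using c by (elim disjE) (simp_all only: pderiv_psi_reflect[OF as as] minus_zero)
    then show "poly (pderiv (alt_pair_form (?h k) (?h l))) ?c = 0"
      by (simp add: alt_pair_form_def h_0[OF k] h_0[OF l] pderiv_minus)
  qed (use assms in \<open>simp_all add: degree_antisym_family\<close>)
  then show ?thesis
    using odd_family_antisym_family[of n m] by blast
qed

text \<open>Parity keeps the two kinds of zeros apart, so their multiplicities add up.\<close>

lemma tau_neq: "tau m \<noteq> - 1 - tau k"
proof
  assume eq: "tau m = - 1 - tau k"
  then have "even m \<longleftrightarrow> odd k"
    by (auto simp: tau_def split: if_splits)
  moreover from this eq have "m = k"
    by (auto simp: tau_def split: if_splits)
  ultimately show False
    by simp
qed

lemma signed_sum_poly:
  "\<exists>a. \<forall>r. (\<Sum>T \<in> symplectic_tableaux n r. (- 1 :: real) ^ num_squares T) =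
     a * (\<Prod>m<n. (tau (n + r) - tau m) ^ (n - m) * (tau (n + r) + 1 + tau m) ^ (n - Suc m))"
proof -
  define W where "W r = (\<Sum>T \<in> symplectic_tableaux n r. (- 1 :: real) ^ num_squares T)" for r
  have scale: "\<exists>C. C \<noteq> 0 \<and> (\<forall>r. poly P (tau (n + r)) = C * W r)"
    if q: "odd_family 0 n q"
      and P: "\<And>N. poly P (tau N) = chain_sum (\<lambda>l k. (- 1) ^ l * poly (q k) (real l)) N {0..<n}" for q P
  proof -
    obtain C :: real where C: "C \<noteq> 0" "\<And>g r. chain_sum (\<lambda>l k. g ^ l * poly (q k) (real l))
        (n + r) {0..<n} = C * g ^ \<Sum>{1..n} * (\<Sum>T \<in> symplectic_tableaux n r. g ^ num_squares T)"
      using chain_sum_eq_tableaux[OF q] by blast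
    have "poly P (tau (n + r)) = (C * (- 1) ^ \<Sum>{1..n}) * W r" for r
      unfolding P C(2) W_def ..
    then show ?thesis
      using C(1) by (intro exI[of _ "C * (- 1) ^ \<Sum>{1..n}"]) simp
  qed
  obtain q0 P0 where q0: "odd_family 0 n q0" and P0: "degree P0 \<le> n * n"
      "\<And>N. poly P0 (tau N) = chain_sum (\<lambda>l k. (- 1) ^ l * poly (q0 k) (real l)) N {0..<n}"
    using signed_family_tau[of 0 n] by auto
  obtain C0 where C0: "C0 \<noteq> 0" "\<And>r. poly P0 (tau (n + r)) = C0 * W r"
    using scale[OF q0 P0(2)] by blast
  have dvd: "D dvd P0" if q: "odd_family 0 n q" and D: "D dvd P"
      and P: "\<And>N. poly P (tau N) = chain_sum (\<lambda>l k. (- 1) ^ l * poly (q k) (real l)) N {0..<n}" for q P D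
  proof -
    obtain C where C: "C \<noteq> 0" "\<And>r. poly P (tau (n + r)) = C * W r"
      using scale[OF q P] by blast
    have "smult C P0 = smult C0 P"
    proof (rule poly_eqI_inj[of "\<lambda>r. tau (n + r)"])
      show "inj (\<lambda>r. tau (n + r))"
        by (auto intro!: injI dest!: injD[OF inj_tau])
    qed (simp add: C C0)
    then show ?thesis
      using C(1) D by (metis dvd_smult dvd_smult_cancel)
  qed
  let ?a = "\<lambda>i. if snd i then tau (fst i) else - 1 - tau (fst i)"
  let ?e = "\<lambda>i. if snd i then n - fst i else n - Suc (fst i)"
  define Q where "Q = (\<Prod>i \<in> {..<n} \<times> UNIV. [:- ?a i, 1:] ^ ?e i)"
  have "Q dvd P0"
    unfolding Q_def
  proof (rule prod_linear_powers_dvd)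
    show "inj_on ?a ({..<n} \<times> UNIV)"
      using inj_tau tau_neq by (auto simp: inj_on_def inj_def split: if_splits) metis+
    show "[:- ?a i, 1:] ^ ?e i dvd P0" if "i \<in> {..<n} \<times> UNIV" for i
    proof (cases "snd i")
      case True
      have "fst i \<le> n"
        using that by auto
      from signed_family_tau[OF this] have "[:- tau (fst i), 1:] ^ (n - fst i) dvd P0"
        using dvd by blast
      then show ?thesis
        using True by (simp only: if_True)
    next
      case False
      have "fst i < n"
        using that by auto
      from signed_family_opposite[OF this] have "[:- (- 1 - tau (fst i)), 1:] ^ (n - Suc (fst i)) dvd P0"
        using dvd by blast
      then show ?thesis
        using False by (simp only: if_False)
    qed
  qed simp
  moreover have "degree Q = n * n"
  proof -
    have "degree Q = (\<Sum>i \<in> {..<n} \<times> (UNIV :: bool set). degree ([:- ?a i, 1:] ^ ?e i))"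
      unfolding Q_def by (intro degree_prod_eq_sum_degree) auto
    also have "\<dots> = (\<Sum>i \<in> {..<n} \<times> (UNIV :: bool set). ?e i)"
      by (intro sum.cong refl) (simp add: degree_power_eq)
    also have "\<dots> = (\<Sum>m<n. \<Sum>b\<in>UNIV. if b then n - m else n - Suc m)"
      by (simp only: sum.cartesian_product case_prod_unfold)
    also have "\<dots> = (\<Sum>m<n. (n - Suc m) + Suc (n - Suc m))"
      by (intro sum.cong refl) (simp add: UNIV_bool)
    also have "\<dots> = (\<Sum>m<n. m + Suc m)"
      by (rule sum.nat_diff_reindex)
    also have "\<dots> = n * n"
      by (induction n) auto
    finally show ?thesis .
  qed
  ultimately obtain a where a: "P0 = smult a Q"
    using dvd_prod_imp_eq[of Q P0] P0(1) by auto
  have "poly Q x = (\<Prod>m<n. (x - tau m) ^ (n - m) * (x + 1 + tau m) ^ (n - Suc m))" for x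
  proof -
    have "poly Q x = (\<Prod>m<n. \<Prod>b\<in>UNIV. (x - (if b then tau m else - 1 - tau m)) ^
        (if b then n - m else n - Suc m))"
      by (simp add: Q_def poly_prod prod.cartesian_product case_prod_unfold)
    moreover have "x - (- 1 - tau m) = x + 1 + tau m" for m
      by simp
    ultimately show ?thesis
      by (simp add: UNIV_bool mult.commute)
  qed
  then have "W r = (a / C0) *
      (\<Prod>m<n. (tau (n + r) - tau m) ^ (n - m) * (tau (n + r) + 1 + tau m) ^ (n - Suc m))" for r
    using C0(1) C0(2)[of r] by (simp add: a eq_divide_eq mult.commute)
  then show ?thesis
    unfolding W_def by blast
qed

section \<open>Evaluation of the products\<close>

text \<open>In a rectangle of \<open>k + 1\<close> by \<open>k\<close> cells the antidiagonals with
  \<open>i + j + 1\<close> equal to \<open>k - m\<close> and to \<open>k + m + 1\<close> have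
  \<open>k - m\<close> cells each. The induction strips the first and the last row and transposes
  the rest, a smaller rectangle of the same kind for a shifted \<open>g\<close>.\<close>

lemma prod_rectangle:
  fixes g :: "nat \<Rightarrow> real"
  shows "(\<Prod>i<Suc k. \<Prod>j<k. g (Suc (i + j))) = (\<Prod>m<k. (g (k - m) * g (k + m + 1)) ^ (k - m))"
proof (induction k arbitrary: g)
  case (Suc k)
  let ?F = "\<lambda>i. \<Prod>j<Suc k. g (Suc (i + j))"
  have "(\<Prod>i<Suc (Suc k). ?F i) = (?F 0 * ?F (Suc k)) * (\<Prod>i<k. ?F (Suc i))"
    by (simp only: prod.lessThan_Suc[of _ "Suc k"] prod.lessThan_Suc_shift[of _ k] mult_ac)
  also have "(\<Prod>i<k. ?F (Suc i)) = (\<Prod>j<Suc k. \<Prod>i<k. g (Suc (Suc (j + i))))"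
    by (subst prod.swap) (simp only: add_ac add_Suc_right add_Suc)
  also have "\<dots> = (\<Prod>m<k. (g (Suc (k - m)) * g (Suc (k + m + 1))) ^ (k - m))"
    by (rule Suc.IH[of "\<lambda>t. g (Suc t)"])
  also have "\<dots> = (\<Prod>m<Suc k. (g (Suc k - m) * g (Suc k + m + 1)) ^ (k - m))"
    by (simp add: Suc_diff_le)
  also have "?F 0 * ?F (Suc k) = (\<Prod>m<Suc k. g (Suc k - m) * g (Suc k + m + 1))"
  proof -
    have "?F 0 = (\<Prod>m<Suc k. g (Suc (Suc k - Suc m)))"
      by (subst prod.nat_diff_reindex[of "\<lambda>m. g (Suc m)"]) simp
    also have "\<dots> = (\<Prod>m<Suc k. g (Suc k - m))"
      by (intro prod.cong refl) (simp add: Suc_diff_le)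
    finally show ?thesis
      by (simp add: prod.distrib)
  qed
  also have "\<dots> * (\<Prod>m<Suc k. (g (Suc k - m) * g (Suc k + m + 1)) ^ (k - m)) =
      (\<Prod>m<Suc k. (g (Suc k - m) * g (Suc k + m + 1)) ^ (Suc k - m))"
    unfolding prod.distrib[symmetric] by (intro prod.cong refl) (simp add: Suc_diff_le)
  finally show ?case .
qed simp

text \<open>Up to the sign \<open>(- 1) ^ N\<close>, the difference is whichever of
  \<open>N - m\<close> and \<open>N + m + 1\<close> is even. For \<open>N = n + r\<close> these run
  through twice the numbers from \<open>r div 2 + 1\<close> to \<open>r div 2 + n\<close>, in some
  order.\<close>

lemma prod_tau_diff:
  "(\<Prod>m<n. tau (n + r) - tau m) = ((- 1) ^ (n + r)) ^ n * (\<Prod>i=1..n. 2 * (real i + real (r div 2)))"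
proof -
  define h where "h N m = (if even N = even m then real N - real m else real N + real m + 1)" for N m
  have "tau N - tau m = (- 1) ^ N * h N m" for N m
    by (simp add: tau_def h_def)
  moreover have "(\<Prod>m<n. h (n + r) m) = (\<Prod>i<n. 2 * (real (Suc i) + real (r div 2)))"
  proof (induction n arbitrary: r)
    case (Suc n)
    have eq: "Suc n + r = n + Suc r"
      by simp
    have "(\<Prod>m<Suc n. h (Suc n + r) m) =
        (\<Prod>i<n. 2 * (real (Suc i) + real (Suc r div 2))) * h (n + Suc r) n"
      unfolding eq using Suc.IH[of "Suc r"] by simp
    \<comment> \<open>With the total \<open>n + Suc r\<close> fixed, the new factor, at
      \<open>m = n\<close>, is the largest of the list when \<open>r\<close> is even and the
      smallest when \<open>r\<close> is odd.\<close>
    also have "\<dots> = (\<Prod>i<Suc n. 2 * (real (Suc i) + real (r div 2)))"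
    proof (cases "even r")
      case True
      then have "Suc r div 2 = r div 2" "h (n + Suc r) n = 2 * (real (Suc n) + real (r div 2))"
        by (auto simp: h_def elim!: evenE)
      then show ?thesis
        by simp
    next
      case False
      then have "Suc r div 2 = Suc (r div 2)" "h (n + Suc r) n = 2 * (real (Suc 0) + real (r div 2))"
        by (auto simp: h_def elim!: oddE)
      then show ?thesis
        by (subst prod.lessThan_Suc_shift) (simp add: add_ac)
    qed
    finally show ?case .
  qed simp
  ultimately show ?thesis
    by (simp add: prod.distrib prod.atLeast1_atMost_eq)
qed

theorem theorem4p5:
  fixes n r :: nat
  assumes "n \<ge> 1"
  shows "real (card (symplectic_tableaux n r)) =
           (\<Prod>i = 1..n + 1. \<Prod>j = 1..n. (real i + real j + real r - 1) / (real i + real j - 1))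
       \<and> (\<Sum>T \<in> symplectic_tableaux n r. (- 1 :: real) ^ num_squares T) =
           (- 1) ^ (r * n)
           * (\<Prod>i = 1..n. (real i + of_int \<lfloor>real r / 2\<rfloor>) / real i)
           * (\<Prod>i = 1..n. \<Prod>j = 1..n - 1. (real i + real j + real r) / (real i + real j))"
proof
  have rect: "(\<Prod>m<k. ((real k + c - real m) * (real k + c + real m + 1)) ^ (k - m)) =
      (\<Prod>i<Suc k. \<Prod>j<k. real (Suc (i + j)) + c)" for k c
    unfolding prod_rectangle[of "\<lambda>t. real t + c"]
    by (intro prod.cong refl) (simp add: of_nat_diff algebra_simps)
  show "real (card (symplectic_tableaux n r)) =
      (\<Prod>i = 1..n + 1. \<Prod>j = 1..n. (real i + real j + real r - 1) / (real i + real j - 1))"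
  proof -
    define R where "R c = (\<Prod>i<Suc n. \<Prod>j<n. real (Suc (i + j)) + c)" for c
    obtain a where a: "\<And>r. real (card (symplectic_tableaux n r)) = a * R (real r)"
      using unsigned_count_poly[of n] unfolding R_def rect by blast
    have "a * R 0 = 1"
      using a[of 0] by (simp add: symplectic_tableaux_0)
    then have "real (card (symplectic_tableaux n r)) = R (real r) / R 0"
      unfolding a by (metis mult.commute mult_zero_right nonzero_mult_div_cancel_left
          nonzero_divide_eq_eq one_neq_zero mult.left_neutral mult.assoc)
    also have "\<dots> = (\<Prod>i<Suc n. \<Prod>j<n. (real (Suc (i + j)) + real r) / real (Suc (i + j)))"
      by (simp add: R_def prod_dividef)
    also have "\<dots> = (\<Prod>i = 1..n + 1. \<Prod>j = 1..n. (real i + real j + real r - 1) / (real i + real j - 1))"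
      by (simp add: prod.atLeast1_atMost_eq add_ac)
    finally show ?thesis .
  qed
  show "(\<Sum>T \<in> symplectic_tableaux n r. (- 1 :: real) ^ num_squares T) =
           (- 1) ^ (r * n)
           * (\<Prod>i = 1..n. (real i + of_int \<lfloor>real r / 2\<rfloor>) / real i)
           * (\<Prod>i = 1..n. \<Prod>j = 1..n - 1. (real i + real j + real r) / (real i + real j))"
  proof -
    define A where "A r = (\<Prod>i=1..n. 2 * (real i + real (r div 2)))" for r
    \<comment> \<open>The rectangle has sides \<open>n\<close> and \<open>n - 1\<close>; writing
      \<open>n + r\<close> as \<open>(n - 1) + (r + 1)\<close> gives the shift
      \<open>r + 1\<close>.\<close>
    define B where "B r = (\<Prod>i<n. \<Prod>j<n - 1. real (Suc (i + j)) + (real r + 1))" for r :: nat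
    obtain a where a: "\<And>r. (\<Sum>T \<in> symplectic_tableaux n r. (- 1 :: real) ^ num_squares T) =
       a * (\<Prod>m<n. (tau (n + r) - tau m) ^ (n - m) * (tau (n + r) + 1 + tau m) ^ (n - Suc m))"
      using signed_sum_poly[of n] by blast
    have prod: "(\<Prod>m<n. (tau (n + r) - tau m) ^ (n - m) * (tau (n + r) + 1 + tau m) ^ (n - Suc m)) =
        ((- 1) ^ (n + r)) ^ n * A r * B r" for r
    proof -
      \<comment> \<open>Both sides are differences of values of \<open>x (x + 1)\<close>, which is
        invariant under \<open>x \<mapsto> - 1 - x\<close>, so \<open>tau\<close>
        disappears.\<close>
      have pair: "(tau N - tau m) * (tau N + 1 + tau m) = (real N - real m) * (real N + real m + 1)" for N m
        by (simp add: tau_def algebra_simps)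
      have "(\<Prod>m<n. (tau (n + r) - tau m) ^ (n - m) * (tau (n + r) + 1 + tau m) ^ (n - Suc m)) =
          (\<Prod>m<n. (tau (n + r) - tau m) *
            ((tau (n + r) - tau m) * (tau (n + r) + 1 + tau m)) ^ (n - Suc m))"
      proof (intro prod.cong refl)
        fix m assume "m \<in> {..<n}"
        then have "n - m = Suc (n - Suc m)"
          by auto
        then show "(tau (n + r) - tau m) ^ (n - m) * (tau (n + r) + 1 + tau m) ^ (n - Suc m) =
            (tau (n + r) - tau m) * ((tau (n + r) - tau m) * (tau (n + r) + 1 + tau m)) ^ (n - Suc m)"
          by (simp only: power_Suc power_mult_distrib mult_ac)
      qed
      also have "\<dots> = (\<Prod>m<n. tau (n + r) - tau m) *
          (\<Prod>m<n. ((real (n + r) - real m) * (real (n + r) + real m + 1)) ^ (n - Suc m))"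
        unfolding pair by (rule prod.distrib)
      also have "(\<Prod>m<n. ((real (n + r) - real m) * (real (n + r) + real m + 1)) ^ (n - Suc m)) = B r"
      proof -
        obtain k where k: "n = Suc k"
          using assms by (cases n) auto
        have "(\<Prod>m<n. ((real (n + r) - real m) * (real (n + r) + real m + 1)) ^ (n - Suc m)) =
            (\<Prod>m<k. ((real k + (real r + 1) - real m) * (real k + (real r + 1) + real m + 1)) ^ (k - m))"
          by (simp add: k add_ac)
        then show ?thesis
          unfolding rect by (simp add: B_def k)
      qed
      finally show ?thesis
        by (simp add: prod_tau_diff A_def)
    qed
    let ?s = "\<lambda>N. ((- 1 :: real) ^ N) ^ n"
    have "a * (?s n * A 0 * B 0) = 1"
      using a[of 0] prod[of 0] by (simp add: symplectic_tableaux_0 num_squares_def shape_def)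
    then have one: "(a * ?s n) * (A 0 * B 0) = 1"
      by (simp only: mult.assoc)
    have ss: "?s n * ?s n = 1"
      by (simp flip: power_mult_distrib)
    have "A 0 * B 0 \<noteq> 0"
      using one by auto
    then have "a * ?s n = 1 / (A 0 * B 0)"
      using one by (simp only: eq_divide_eq) simp
    then have a_eq: "a = ?s n / (A 0 * B 0)"
      using ss by (metis mult.assoc mult.right_neutral times_divide_eq_left mult_1)
    have "(\<Sum>T \<in> symplectic_tableaux n r. (- 1 :: real) ^ num_squares T) =
        (?s n * ?s (n + r)) * (A r / A 0) * (B r / B 0)"
      unfolding a prod a_eq by simp
    \<comment> \<open>The exponent is \<open>2 * n * n + r * n\<close>; one half of its even part
      comes from normalizing at \<open>r = 0\<close>.\<close>
    also have "?s n * ?s (n + r) = (- 1) ^ (r * n)"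
      by (simp add: power_add power_mult_distrib power_mult[symmetric] mult.assoc[symmetric]
          flip: power2_eq_square)
    also have "A r / A 0 = (\<Prod>i = 1..n. (real i + of_int \<lfloor>real r / 2\<rfloor>) / real i)"
    proof -
      have "\<lfloor>real r / 2\<rfloor> = int (r div 2)"
        using floor_divide_of_nat_eq[of r 2, where ?'a = real] by simp
      then show ?thesis
        by (simp add: A_def prod_dividef[symmetric] del: distrib_left_numeral)
    qed
    also have "B r / B 0 = (\<Prod>i = 1..n. \<Prod>j = 1..n - 1. (real i + real j + real r) / (real i + real j))"
      by (simp add: B_def prod_dividef[symmetric] prod.atLeast1_atMost_eq add_ac)
    finally show ?thesis .
  qed
qed

end
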